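(* Let $L\ge3$ be a positive odd integer and let $a,b:\mathbb{R}^3\to\mathbb{R}$ be smooth ($C^\infty$) functions with $a(x)\neq0$ and $b(x)\neq0$ for all $x\in\mathbb{R}^3$. Then the system $$\dot x_1=a(x_1,x_2,x_3)\,x_3^L,\qquad \dot x_2=b(x_1,x_2,x_3)\,x_3,\qquad \dot x_3=u,\qquad (x_1,x_2,x_3)\in\mathbb{R}^3,$$ with input $u\in\mathbb{R}$, is SDF-SGAS.
   Context: Notation. $\mathbb{R}^+=[0,\infty)$; $|x|$ is the Euclidean norm; $B[0,R]=\{x\in\mathbb{R}^n:|x|\le R\}$. Definition (SDF-SGAS). A system $\dot x=F(x,u)$, $(x,u)\in\mathbb{R}^n\times\mathbb{R}^m$, $F(0,0)=0$, is Semi-Globally Asymptotically Stabilizable by Sampled-Data Feedback (SDF-SGAS) if for every $R>0$ and for any given partition of times $T_1:=0<T_2<T_3<\cdots<T_\nu<\cdots$ with $T_\nu\to\infty$ there exist a neighborhood $\Pi$ of zero with $B[0,R]\subset\Pi$ and a map $k:\mathbb{R}^+\times\Pi\to\mathbb{R}^m$ such that for any $x\in\Pi$ the map $k(\cdot,x):\mathbb{R}^+\to\mathbb{R}^m$ is measurable and locally essentially bounded, and the trajectory $x(\cdot)$ of the sampled-data closed-loop system $\dot x=F(x,k(t,x(T_i)))$, $t\in[T_i,T_{i+1})$, $i=1,2,\ldots$, $x(0)\in\Pi$, satisfies: Stability: for every $\varepsilon>0$ there is $\delta=\delta(\varepsilon)>0$ such that $x(0)\in\Pi$, $|x(0)|\le\delta$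 imply $|x(t)|\le\varepsilon$ for all $t\ge0$; Attractivity: $\lim_{t\to\infty}x(t)=0$ for all $x(0)\in\Pi$. *)

theory Defs
  imports "HOL-Analysis.Analysis"
begin

(* C^n on the whole space, through iterated directional derivatives; for n > 0 all
   intermediate functions are required to be Frechet differentiable everywhere. *)
fun Ck :: "nat \<Rightarrow> ('a::real_normed_vector \<Rightarrow> 'b::real_normed_vector) \<Rightarrow> bool" where
  "Ck 0 f \<longleftrightarrow> continuous_on UNIV f"
| "Ck (Suc n) f \<longleftrightarrow>
     (\<forall>x. f differentiable (at x)) \<and> (\<forall>v. Ck n (\<lambda>x. frechet_derivative f (at x) v))"

definition smooth :: "('a::real_normed_vector \<Rightarrow> 'b::real_normed_vector) \<Rightarrow> bool" where
  "smooth f \<longleftrightarrow> (\<forall>n. Ck n f)"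

(* Sampling times are indexed from 0. *)
definition sampling_partition :: "(nat \<Rightarrow> real) \<Rightarrow> bool" where
  "sampling_partition T \<longleftrightarrow> T 0 = 0 \<and> strict_mono T \<and> filterlim T at_top sequentially"

definition locally_ess_bounded :: "(real \<Rightarrow> 'b::real_normed_vector) \<Rightarrow> bool" where
  "locally_ess_bounded u \<longleftrightarrow>
     (\<forall>K. compact K \<and> K \<subseteq> {0..} \<longrightarrow> (\<exists>C. AE t in lebesgue_on K. norm (u t) \<le> C))"

(* The feedback is only meaningful for t >= 0 and states in D; its values elsewhere are
   never used. *)
definition admissible_feedback ::
    "(real ^ 'n) set \<Rightarrow> (real \<Rightarrow> real ^ 'n \<Rightarrow> real ^ 'm) \<Rightarrow> bool" where
  "admissible_feedback D k \<longleftrightarrow>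
     (\<forall>\<xi>\<in>D. (\<lambda>t. k t \<xi>) \<in> borel_measurable (lebesgue_on {0..}) \<and>
            locally_ess_bounded (\<lambda>t. k t \<xi>))"

(* A Caratheodory solution on [0, \<infinity>), i.e. x is locally absolutely continuous and satisfies
   the equation almost everywhere, written in integral form on each sampling interval.  Since
   k is given on D only, the sampled states x (T i) have to lie in D. *)
definition sampled_data_trajectory ::
    "(real ^ 'n \<Rightarrow> real ^ 'm \<Rightarrow> real ^ 'n) \<Rightarrow> (nat \<Rightarrow> real) \<Rightarrow> (real ^ 'n) set \<Rightarrow>
     (real \<Rightarrow> real ^ 'n \<Rightarrow> real ^ 'm) \<Rightarrow> (real \<Rightarrow> real ^ 'n) \<Rightarrow> bool" where
  "sampled_data_trajectory F T D k x \<longleftrightarrow>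
     (\<forall>i. x (T i) \<in> D \<and>
       (\<forall>t\<in>{T i..T (Suc i)}.
         (\<lambda>s. F (x s) (k s (x (T i)))) absolutely_integrable_on {T i..t} \<and>
         x t = x (T i) + integral {T i..t} (\<lambda>s. F (x s) (k s (x (T i))))))"

definition SDF_SGAS :: "(real ^ 'n \<Rightarrow> real ^ 'm \<Rightarrow> real ^ 'n) \<Rightarrow> bool" where
  "SDF_SGAS F \<longleftrightarrow> F 0 0 = 0 \<and>
     (\<forall>R>0. \<forall>T. sampling_partition T \<longrightarrow>
       (\<exists>D k. 0 \<in> interior D \<and> cball 0 R \<subseteq> D \<and> admissible_feedback D k \<and>
         (\<forall>x0\<in>D. \<exists>x. sampled_data_trajectory F T D k x \<and> x 0 = x0) \<and>
         (\<forall>\<epsilon>>0. \<exists>\<delta>>0. \<forall>x. sampled_data_trajectory F T D k x \<and> norm (x 0) \<le> \<delta> \<longrightarrow>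
            (\<forall>t\<ge>0. norm (x t) \<le> \<epsilon>)) \<and>
         (\<forall>x. sampled_data_trajectory F T D k x \<longrightarrow> (x \<longlongrightarrow> 0) at_top)))"

end

theory Submission
  imports Defs
begin

text \<open>The third state is an integrator, so on a sampling interval it can be made to follow any
\<open>C\<^sup>1\<close> profile that starts at its sampled value; the control is the derivative of that
profile. Let \<open>x\<^sub>3 t = A * \<phi> ((t - t\<^sub>0) / h)\<close> be a pulse which starts and ends at zero. During
the pulse the state stays within \<open>2 * \<bar>A\<bar>\<close> of the sampled state \<open>\<xi>\<close>, and \<open>a\<close>, \<open>b\<close> are
Lipschitz on bounded sets, so the pulse changes \<open>x\<^sub>1\<close> by \<open>a \<xi> * A ^ L * h * \<integral> \<phi> ^ L\<close> and
\<open>x\<^sub>2\<close> by \<open>b \<xi> * A * h * \<integral> \<phi>\<close>, up to errors of order \<open>\<bar>A\<bar> ^ (L + 1) * h\<close> and \<open>\<bar>A\<bar>\<^sup>2 * h\<close>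
(lemma \<open>net_displacement\<close>).

Two pulses therefore move the two remaining states almost independently. A nonnegative bump moves
\<open>x\<^sub>2\<close>. A high short positive tooth followed by a low long negative tooth of the same area has mean
zero, but a positive \<open>L\<close>-th moment, because \<open>L > 1\<close> favours the high tooth; this skew pulse moves
\<open>x\<^sub>1\<close> and leaves \<open>x\<^sub>2\<close> unchanged to first order. As \<open>L\<close> is odd, the sign of \<open>A\<close> decides
the direction in both cases, and as \<open>a\<close> and \<open>b\<close> do not vanish, the gain is bounded below on
compact sets.

Balancing the two effects gives \<open>V = \<bar>x\<^sub>1\<bar> + \<bar>x\<^sub>2\<bar> ^ L\<close> as Lyapunov function. If
\<open>\<bar>x\<^sub>2\<bar> \<le> \<mu>\<^sup>2 * \<bar>x\<^sub>1\<bar> powr (1 / L)\<close>, a skew pulse of amplitude \<open>\<mu> * \<bar>x\<^sub>1\<bar> powr (1 / L)\<close>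
reduces \<open>x\<^sub>1\<close>, otherwise a bump of amplitude \<open>\<mu> * \<bar>x\<^sub>2\<bar>\<close> reduces \<open>x\<^sub>2\<close>. For small \<open>\<mu>\<close> the
decrease dominates the unwanted change of the other state, and \<open>V\<close> drops by a factor
\<open>1 - rate * h\<close> with a constant \<open>rate > 0\<close> (lemmas \<open>small_second_decrease\<close> and
\<open>large_second_decrease\<close>). The window \<open>h\<close> is the length of the sampling interval, cut off at a
constant. As the sampling times tend to infinity, these windows have infinite sum, hence \<open>V\<close>
tends to zero along the samples whatever the partition is.

If the sampled state has \<open>x\<^sub>3 \<noteq> 0\<close>, a ramp brings \<open>x\<^sub>3\<close> to zero first; this happens on the first
interval only. In all cases the amplitude, and with it the excursion between two samples, is bounded
by a continuous function of the sampled state that vanishes at zero. This gives stability, and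
turns convergence at the samples into convergence of the trajectory.\<close>

section \<open>Analytic preliminaries\<close>

lemma smooth_lipschitz_on_compact_convex:
  fixes f :: "'a::euclidean_space \<Rightarrow> 'b::real_normed_vector"
  assumes "smooth f" and "compact S" and "convex S"
  obtains C where "C \<ge> 0" and "\<And>x y. x \<in> S \<Longrightarrow> y \<in> S \<Longrightarrow> norm (f x - f y) \<le> C * norm (x - y)"
proof -
  have "Ck 1 f" using assms(1) by (simp add: smooth_def)
  then have diff: "f differentiable (at x)"
    and cont: "continuous_on UNIV (\<lambda>x. frechet_derivative f (at x) v)" for x v
    by (simp_all)
  let ?D = "\<lambda>x. frechet_derivative f (at x)"
  have "\<exists>B. \<forall>x\<in>S. norm (?D x v) \<le> B" for v
  proof -
    have "continuous_on S (\<lambda>x. ?D x v)"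
      using cont by (rule continuous_on_subset) simp
    then show ?thesis using continuous_on_compact_bound[OF assms(2)] by metis
  qed
  then obtain B where B: "\<And>v x. x \<in> S \<Longrightarrow> norm (?D x v) \<le> B v" by metis
  define C where "C = (\<Sum>i\<in>Basis. \<bar>B i\<bar>)"
  have "onorm (?D x) \<le> C" if x: "x \<in> S" for x
  proof (rule onorm_le)
    fix v
    have lin: "linear (?D x)" using diff by (rule linear_frechet_derivative)
    have "norm (?D x v) = norm (?D x (\<Sum>i\<in>Basis. (v \<bullet> i) *\<^sub>R i))"
      by (simp add: euclidean_representation)
    also have "\<dots> = norm (\<Sum>i\<in>Basis. (v \<bullet> i) *\<^sub>R ?D x i)"
      using lin by (simp add: linear_sum linear_cmul)
    also have "\<dots> \<le> (\<Sum>i\<in>Basis. norm v * \<bar>B i\<bar>)"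
    proof (rule sum_norm_le)
      fix i :: 'a assume i: "i \<in> Basis"
      have "norm ((v \<bullet> i) *\<^sub>R ?D x i) = \<bar>v \<bullet> i\<bar> * norm (?D x i)" by simp
      also have "\<dots> \<le> norm v * \<bar>B i\<bar>"
        using Basis_le_norm[OF i, of v] B[OF x, of i] by (intro mult_mono) auto
      finally show "norm ((v \<bullet> i) *\<^sub>R ?D x i) \<le> norm v * \<bar>B i\<bar>" .
    qed
    also have "\<dots> = C * norm v" by (simp add: C_def sum_distrib_left mult.commute)
    finally show "norm (?D x v) \<le> C * norm v" .
  qed
  moreover have "(f has_derivative ?D x) (at x within S)" for x
    using diff by (simp add: frechet_derivative_works has_derivative_at_withinI)
  ultimately have "norm (f x - f y) \<le> C * norm (x - y)" if "x \<in> S" "y \<in> S" for x y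
    using that assms(3) by (intro differentiable_bound[where f' = ?D and S = S]) auto
  moreover have "C \<ge> 0" unfolding C_def by (intro sum_nonneg) auto
  ultimately show thesis using that by blast
qed

text \<open>Picard iteration on an interval so short that the integral operator contracts. The solution is
constant after \<open>b\<close> because the operator stops integrating there.\<close>

lemma picard_fixed_point:
  fixes G :: "real \<Rightarrow> 'a::euclidean_space \<Rightarrow> 'a"
  assumes ab: "a \<le> b" and K: "0 \<le> K" "K * (b - a) < 1"
    and cont: "\<And>x. continuous_on {a..b} x \<Longrightarrow> continuous_on {a..b} (\<lambda>s. G s (x s))"
    and lip: "\<And>s x y. s \<in> {a..b} \<Longrightarrow> norm (G s x - G s y) \<le> K * norm (x - y)"
  obtains x where "\<And>t. t \<in> {a..b} \<Longrightarrow> x t = \<xi> + integral {a..t} (\<lambda>s. G s (x s))"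
    and "continuous_on UNIV x" and "\<And>t. t \<ge> b \<Longrightarrow> x t = x b"
proof -
  \<comment> \<open>Clamping the time to [a, b] lets the operator act on bounded continuous functions on the whole line.\<close>
  define c where "c t = max a (min b t)" for t :: real
  have cin: "c t \<in> {a..b}" for t using ab by (auto simp: c_def)
  define \<Phi> where "\<Phi> X t = \<xi> + integral {a..c t} (\<lambda>s. G s (apply_bcontfun X s))"
    for X :: "real \<Rightarrow>\<^sub>C 'a" and t
  have contG: "continuous_on {a..b} (\<lambda>s. G s (apply_bcontfun X s))" for X
    by (rule cont) simp
  have contI: "continuous_on {a..b} (\<lambda>t. integral {a..t} (\<lambda>s. G s (apply_bcontfun X s)))" for X
    by (intro indefinite_integral_continuous_1 integrable_continuous_interval contG)
  have cont\<Phi>: "continuous_on UNIV (\<Phi> X)" for X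
    unfolding \<Phi>_def
    by (intro continuous_intros continuous_on_compose2[OF contI[of X]])
      (use cin in \<open>auto simp: c_def intro!: continuous_intros\<close>)
  have bdd: "\<Phi> X \<in> bcontfun" for X
  proof -
    obtain B where B: "\<And>t. t \<in> {a..b} \<Longrightarrow>
        norm (integral {a..t} (\<lambda>s. G s (apply_bcontfun X s))) \<le> B"
      using continuous_on_compact_bound[OF compact_Icc contI] by metis
    show ?thesis
    proof (rule bcontfun_normI[OF cont\<Phi>])
      fix t show "norm (\<Phi> X t) \<le> norm \<xi> + B"
        unfolding \<Phi>_def by (rule norm_triangle_le) (use B[OF cin[of t]] in simp)
    qed
  qed
  define \<Psi> where "\<Psi> X = Bcontfun (\<Phi> X)" for X
  have app: "apply_bcontfun (\<Psi> X) = \<Phi> X" for X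
    unfolding \<Psi>_def using bdd by (simp add: Bcontfun_inverse)
  have "\<exists>!X. X \<in> UNIV \<and> \<Psi> X = X"
  proof (rule Banach_fix)
    show "complete (UNIV :: (real \<Rightarrow>\<^sub>C 'a) set)" by (rule complete_UNIV)
    show "0 \<le> K * (b - a)" using ab K by simp
    show "K * (b - a) < 1" by fact
    fix X Y :: "real \<Rightarrow>\<^sub>C 'a"
    show "dist (\<Psi> X) (\<Psi> Y) \<le> K * (b - a) * dist X Y"
    proof (rule dist_bound)
      fix t
      let ?g = "\<lambda>s. G s (apply_bcontfun X s) - G s (apply_bcontfun Y s)"
      have sub: "continuous_on {a..c t} (\<lambda>s. G s (apply_bcontfun Z s))" for Z
        by (rule continuous_on_subset[OF contG[of Z]]) (use cin[of t] in auto)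
      have "dist (\<Psi> X t) (\<Psi> Y t) = norm (integral {a..c t} ?g)"
        unfolding app \<Phi>_def
        by (subst Henstock_Kurzweil_Integration.integral_diff)
          (auto intro!: integrable_continuous_interval sub simp: dist_norm)
      also have "\<dots> \<le> (K * dist X Y) * (c t - a)"
      proof (rule integral_bound)
        show "a \<le> c t" using cin[of t] by simp
        show "continuous_on {a..c t} ?g" by (intro continuous_intros sub)
        fix s assume "s \<in> {a..c t}"
        then have "s \<in> {a..b}" using cin[of t] by auto
        then have "norm (?g s) \<le> K * dist (X s) (Y s)" using lip by (simp add: dist_norm)
        also have "\<dots> \<le> K * dist X Y" using K dist_bounded by (intro mult_left_mono) auto
        finally show "norm (?g s) \<le> K * dist X Y" .
      qed
      also have "\<dots> \<le> (K * dist X Y) * (b - a)"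
        using cin[of t] K by (intro mult_left_mono) auto
      finally show "dist (\<Psi> X t) (\<Psi> Y t) \<le> K * (b - a) * dist X Y" by (simp add: mult_ac)
    qed
  qed auto
  then obtain X where X: "\<Psi> X = X" by blast
  have fix': "apply_bcontfun X t = \<xi> + integral {a..c t} (\<lambda>s. G s (apply_bcontfun X s))" for t
    using fun_cong[OF app[of X], of t] unfolding X \<Phi>_def .
  show thesis
  proof (rule that)
    show "apply_bcontfun X t = \<xi> + integral {a..t} (\<lambda>s. G s (apply_bcontfun X s))" if "t \<in> {a..b}" for t
      by (subst fix') (use that in \<open>simp add: c_def\<close>)
    show "apply_bcontfun X t = apply_bcontfun X b" if "t \<ge> b" for t
    proof -
      have "c t = c b" using that ab by (simp add: c_def)
      then show ?thesis by (metis fix')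
    qed
  qed simp
qed

text \<open>A function that satisfies the strong bound \<open>c\<close> as long as it satisfies the weak bound \<open>d\<close>
never reaches \<open>d\<close>: at the first time when it does, the strong bound already holds. It confines
trajectories to the ball on which the coefficients are controlled.\<close>

lemma first_exit_bootstrap:
  fixes f :: "real \<Rightarrow> real"
  assumes cont: "continuous_on {a..b} f" and fa: "f a \<le> c" and cd: "c < d"
    and step: "\<And>t. t \<in> {a..b} \<Longrightarrow> (\<And>s. s \<in> {a..t} \<Longrightarrow> f s \<le> d) \<Longrightarrow> f t \<le> c"
    and t: "t \<in> {a..b}"
  shows "f t \<le> c"
proof -
  have all: "f s \<le> d" if s: "s \<in> {a..b}" for s
  proof (rule ccontr)
    assume "\<not> f s \<le> d"
    define E where "E = {r \<in> {a..b}. f r \<ge> d}"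
    have "closed E" unfolding E_def
      by (rule continuous_on_closed_Collect_le[OF continuous_on_const cont]) auto
    moreover have "s \<in> E" using \<open>\<not> f s \<le> d\<close> s by (simp add: E_def)
    moreover have bb: "bdd_below E" by (rule bdd_belowI[of _ a]) (auto simp: E_def)
    ultimately have inf: "Inf E \<in> E" using closed_contains_Inf by blast
    have before: "f r < d" if "r \<in> {a..<Inf E}" for r
    proof (rule ccontr)
      assume "\<not> f r < d"
      then have "r \<in> E" using that inf by (auto simp: E_def)
      then show False using cInf_lower[OF _ bb, of r] that by simp
    qed
    have "a < Inf E" using inf fa cd by (cases "Inf E = a") (auto simp: E_def)
    have "f (Inf E) \<le> d"
    proof (rule continuous_le_on_closure[where f = f and S = "{a..<Inf E}"])
      show "continuous_on (closure {a..<Inf E}) f"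
        using \<open>a < Inf E\<close> cont inf by (auto intro: continuous_on_subset simp: E_def)
    qed (use \<open>a < Inf E\<close> before in \<open>auto simp: less_imp_le\<close>)
    then have "f r \<le> d" if "r \<in> {a..Inf E}" for r
      using before[of r] that by (cases "r = Inf E") auto
    then have "f (Inf E) \<le> c" using inf by (intro step) (auto simp: E_def)
    then show False using inf cd by (simp add: E_def)
  qed
  show ?thesis using t all by (intro step) auto
qed

text \<open>Otherwise the truncated gaps tend to zero, so eventually no gap is truncated, the gaps themselves
are summable, and the sampling times converge.\<close>

lemma truncated_gaps_not_summable:
  fixes T :: "nat \<Rightarrow> real"
  assumes "filterlim T at_top sequentially" and "h0 > 0"
  shows "\<not> summable (\<lambda>i. min (T (Suc i) - T i) h0)"
proof
  assume sum: "summable (\<lambda>i. min (T (Suc i) - T i) h0)"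
  then have "(\<lambda>i. min (T (Suc i) - T i) h0) \<longlonglongrightarrow> 0" by (rule summable_LIMSEQ_zero)
  then have "\<forall>\<^sub>F i in sequentially. min (T (Suc i) - T i) h0 < h0"
    using assms(2) by (rule order_tendstoD)
  then have "\<forall>\<^sub>F i in sequentially. min (T (Suc i) - T i) h0 = T (Suc i) - T i"
    by eventually_elim auto
  then have "summable (\<lambda>i. T (Suc i) - T i)" using sum by (simp add: summable_cong)
  then have "convergent (\<lambda>n. \<Sum>i<n. T (Suc i) - T i)" by (simp add: summable_iff_convergent)
  then have "convergent (\<lambda>n. T n - T 0)" by (simp add: sum_lessThan_telescope)
  then have "convergent (\<lambda>n. (T n - T 0) + T 0)" by (intro convergent_add convergent_const)
  then have "convergent T" by simp
  then show False
    using not_tendsto_and_filterlim_at_infinity[OF sequentially_bot _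
        filterlim_at_top_imp_at_infinity[OF assms(1)]]
    by (auto simp: convergent_def)
qed

text \<open>A positive limit \<open>l\<close> of \<open>V\<close> would force decrements of at least \<open>c * l * h i\<close>, whose sum is
infinite.\<close>

lemma decay_along_divergent_steps:
  fixes V h :: "nat \<Rightarrow> real"
  assumes nonneg: "\<And>i. V i \<ge> 0" and "\<And>i. h i \<ge> 0" and "c > 0" and "\<not> summable h"
    and step: "\<And>i. V (Suc i) \<le> V i - c * h i * V i"
  shows "decseq V" and "V \<longlonglongrightarrow> 0"
proof -
  show dec: "decseq V"
  proof (rule decseq_SucI)
    fix i
    have "0 \<le> c * h i * V i" using nonneg[of i] assms(2)[of i] assms(3) by simp
    then show "V (Suc i) \<le> V i" using step[of i] by simp
  qed
  obtain l where l: "V \<longlonglongrightarrow> l" and le: "\<And>i. l \<le> V i"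
    using decseq_convergent[OF dec, of 0] nonneg by blast
  have "l \<ge> 0" using l nonneg by (metis LIMSEQ_le_const)
  have "l = 0"
  proof (rule ccontr)
    assume "l \<noteq> 0"
    then have "c * l > 0" using \<open>l \<ge> 0\<close> assms(3) by simp
    have gap: "(c * l) * h i \<le> V i - V (Suc i)" for i
    proof -
      have "(c * l) * h i = c * h i * l" by simp
      also have "\<dots> \<le> c * h i * V i" using le assms(2,3) by (intro mult_left_mono) auto
      also have "\<dots> \<le> V i - V (Suc i)" using step[of i] by simp
      finally show ?thesis .
    qed
    have "summable (\<lambda>i. V i - V (Suc i))"
      using telescope_summable'[OF l] .
    then have "summable (\<lambda>i. (c * l) * h i)"
      by (rule summable_comparison_test'[where N = 0])
        (use gap \<open>c * l > 0\<close> assms(2) in auto)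
    then have "summable h" using \<open>c * l > 0\<close> summable_cmult_iff[of "c * l" h] by auto
    then show False using assms(4) by blast
  qed
  then show "V \<longlonglongrightarrow> 0" using l by simp
qed

lemma isCont_zero_bound:
  fixes f :: "'a::real_normed_vector \<Rightarrow> real"
  assumes "isCont f 0" and "f 0 = 0" and "e > 0"
  obtains d where "d > 0" and "\<And>x. norm x \<le> d \<Longrightarrow> f x \<le> e"
proof -
  obtain d where d: "d > 0" "\<And>x. dist x 0 < d \<Longrightarrow> dist (f x) (f 0) < e"
    using assms(1,3) unfolding continuous_at_eps_delta by metis
  have "f x \<le> e" if "norm x \<le> d / 2" for x
    using d(2)[of x] d(1) that assms(2) by (simp add: dist_real_def)
  then show thesis using that[of "d / 2"] d(1) by simp
qed

section \<open>Pulse profiles\<close>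

definition bump :: "real \<Rightarrow> real" where "bump s = (max 0 (s * (1 - s)))\<^sup>2"

text \<open>Squaring the positive part is continuously differentiable, so profiles of this form extend by zero
without a case distinction in their derivatives.\<close>

lemma has_field_derivative_max0_square:
  fixes f :: "real \<Rightarrow> real"
  assumes "(f has_field_derivative f') (at x)"
  shows "((\<lambda>x. (max 0 (f x))\<^sup>2) has_field_derivative 2 * max 0 (f x) * f') (at x)"
proof -
  have "((\<lambda>y. (max 0 y)\<^sup>2) has_field_derivative 2 * max 0 y) (at y)" for y :: real
  proof (cases y "0 :: real" rule: linorder_cases)
    case less
    have "((\<lambda>_. 0) has_field_derivative 0) (at y)" by simp
    then have "((\<lambda>y. (max 0 y)\<^sup>2) has_field_derivative 0) (at y)"
      by (rule has_field_derivative_transform_within_open[of _ _ _ "{..<0}"]) (use less in auto)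
    then show ?thesis using less by simp
  next
    case equal
    have "((\<lambda>h. ((max 0 (0 + h))\<^sup>2 - (max 0 0)\<^sup>2) / h) \<longlongrightarrow> 0) (at (0::real))"
    proof (rule Lim_null_comparison)
      show "\<forall>\<^sub>F h in at 0. norm (((max 0 (0 + h))\<^sup>2 - (max 0 0)\<^sup>2) / h) \<le> \<bar>h\<bar>" for h :: real
        by (rule always_eventually) (auto simp: max_def power2_eq_square)
      show "((\<lambda>h. \<bar>h\<bar>) \<longlongrightarrow> 0) (at (0::real))" by (intro tendsto_rabs_zero tendsto_ident_at)
    qed
    then show ?thesis using equal by (simp add: DERIV_def)
  next
    case greater
    have "((\<lambda>y. y\<^sup>2) has_field_derivative 2 * y) (at y)" by (auto intro!: derivative_eq_intros)
    then have "((\<lambda>y. (max 0 y)\<^sup>2) has_field_derivative 2 * y) (at y)"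
      by (rule has_field_derivative_transform_within_open[of _ _ _ "{0<..}"]) (use greater in auto)
    then show ?thesis using greater by simp
  qed
  from DERIV_chain2[OF this assms] show ?thesis .
qed

text \<open>The conditions at \<open>0\<close> and beyond \<open>1\<close> make the control vanish at both ends of a sampling
interval. The feedback is then continuous across sampling times, so that it does not matter
to which of two adjacent intervals a sampling time is assigned.\<close>

definition control_shape :: "(real \<Rightarrow> real) \<Rightarrow> (real \<Rightarrow> real) \<Rightarrow> bool" where
  "control_shape \<phi> \<phi>' \<longleftrightarrow>
     (\<forall>s. (\<phi> has_real_derivative \<phi>' s) (at s)) \<and> continuous_on UNIV \<phi>' \<and>
     (\<forall>s\<ge>0. \<bar>\<phi> s\<bar> \<le> 1) \<and> (\<forall>s\<ge>1. \<phi> s = 0 \<and> \<phi>' s = 0) \<and> \<phi>' 0 = 0"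

definition ramp :: "real \<Rightarrow> real" where "ramp s = (max 0 (1 - s\<^sup>2))\<^sup>2"

definition ramp_deriv :: "real \<Rightarrow> real" where
  "ramp_deriv s = 2 * max 0 (1 - s\<^sup>2) * (- (2 * s))"

lemma control_shape_ramp: "control_shape ramp ramp_deriv"
proof -
  have "\<bar>max 0 (1 - s\<^sup>2)\<bar> \<le> 1" for s :: real by simp
  then have "\<bar>(max 0 (1 - s\<^sup>2))\<^sup>2\<bar> \<le> 1" for s :: real by (simp add: abs_square_le_1)
  moreover have "((\<lambda>s. (max 0 (1 - s\<^sup>2))\<^sup>2) has_real_derivative
      2 * max 0 (1 - s\<^sup>2) * (- (2 * s))) (at s)" for s :: real
    by (intro has_field_derivative_max0_square) (auto intro!: derivative_eq_intros)
  moreover have "continuous_on UNIV (\<lambda>s::real. 2 * max 0 (1 - s\<^sup>2) * (- (2 * s)))"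
    by (intro continuous_intros)
  moreover have "max 0 (1 - s\<^sup>2) = 0" if "s \<ge> 1" for s :: real
    using one_le_power[OF that, of 2] by simp
  ultimately show ?thesis
    unfolding control_shape_def ramp_def[abs_def] ramp_deriv_def[abs_def] by simp
qed

lemma integral_control_shape_power_le_1:
  assumes "control_shape \<phi> \<phi>'"
  shows "integral {0..1} (\<lambda>s. \<phi> s ^ n) \<le> 1"
proof -
  have "continuous_on UNIV \<phi>"
    using assms by (intro continuous_at_imp_continuous_on ballI DERIV_isCont[of \<phi> "\<phi>' x" x for x])
      (simp add: control_shape_def)
  then have "continuous_on {0..1} (\<lambda>s. \<phi> s ^ n)"
    by (intro continuous_intros) (auto intro: continuous_on_subset)
  then have "integral {0..1} (\<lambda>s. \<phi> s ^ n) \<le> integral {0..1} (\<lambda>s::real. 1::real)"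
  proof (intro integral_le integrable_continuous_interval)
    fix s :: real assume "s \<in> {0..1}"
    then have "\<bar>\<phi> s ^ n\<bar> \<le> 1" using assms by (simp add: control_shape_def power_abs power_le_one)
    then show "\<phi> s ^ n \<le> 1" by simp
  qed auto
  then show ?thesis by simp
qed

definition bump_deriv :: "real \<Rightarrow> real" where
  "bump_deriv s = 2 * max 0 (s * (1 - s)) * (1 - 2 * s)"

lemma bump_has_derivative: "(bump has_real_derivative bump_deriv s) (at s)"
  unfolding bump_def[abs_def] bump_deriv_def
  by (rule has_field_derivative_max0_square) (auto intro!: derivative_eq_intros)

lemma bump_eq_0: "s \<le> 0 \<or> s \<ge> 1 \<Longrightarrow> bump s = 0 \<and> bump_deriv s = 0"
  by (auto simp: bump_def bump_deriv_def max_def mult_nonneg_nonpos zero_le_mult_iff)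

lemma continuous_bump: "continuous_on A bump" and continuous_bump_deriv: "continuous_on A bump_deriv"
  unfolding bump_def[abs_def] bump_deriv_def[abs_def] by (intro continuous_intros)+

lemma bump_nonneg: "bump s \<ge> 0" by (simp add: bump_def)

lemma bump_le: "bump s \<le> 1/2"
proof -
  have "s * (1 - s) \<le> 1/4" using zero_le_power2[of "s - 1/2"] by (simp add: power2_eq_square algebra_simps)
  then have "(max 0 (s * (1 - s)))\<^sup>2 \<le> (1/4)\<^sup>2" by (intro power_mono) auto
  then show ?thesis by (simp add: bump_def power2_eq_square)
qed

lemma bump_pos: "0 < s \<Longrightarrow> s < 1 \<Longrightarrow> bump s > 0"
  by (simp add: bump_def max_def mult_pos_pos)

lemma integral_bump_power_pos:
  assumes "n \<ge> 1" shows "integral {0..1} (\<lambda>s. bump s ^ n) > 0"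
proof -
  have cont: "continuous_on {0..1} (\<lambda>s. bump s ^ n)" by (intro continuous_intros continuous_bump)
  have "integral {0..1} (\<lambda>s. bump s ^ n) \<noteq> 0"
  proof
    assume "integral {0..1} (\<lambda>s. bump s ^ n) = 0"
    then have "bump (1/2) ^ n = 0"
      using integral_eq_0_iff[OF cont] assms by (auto simp: bump_nonneg)
    then show False using bump_pos[of "1/2"] by simp
  qed
  moreover have "integral {0..1} (\<lambda>s. bump s ^ n) \<ge> 0"
    by (intro integral_nonneg integrable_continuous_interval cont) (simp add: bump_nonneg)
  ultimately show ?thesis by simp
qed

lemma control_shape_bump: "control_shape bump bump_deriv"
  unfolding control_shape_def
  using bump_has_derivative continuous_bump_deriv bump_eq_0 order_trans[OF bump_le, of 1]
  by (auto simp: bump_nonneg)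

text \<open>A tooth of height \<open>1\<close> and width \<open>1/3\<close> (in units of the bump), followed by a negative tooth of
height \<open>1/2\<close> and width \<open>2/3\<close>: equal areas, but unequal higher moments.\<close>

definition skew_pulse :: "real \<Rightarrow> real" where
  "skew_pulse s = bump (3 * s) - bump ((3 * s - 1) / 2) / 2"

definition skew_pulse_deriv :: "real \<Rightarrow> real" where
  "skew_pulse_deriv s = bump_deriv (3 * s) * 3 - bump_deriv ((3 * s - 1) / 2) * (3/2) / 2"

lemma control_shape_skew_pulse: "control_shape skew_pulse skew_pulse_deriv"
proof -
  have b: "bump s \<ge> 0 \<and> bump s \<le> 1/2" for s using bump_nonneg bump_le by simp
  have "\<bar>skew_pulse s\<bar> \<le> 1" for s
    using b[of "3 * s"] b[of "(3 * s - 1) / 2"] unfolding skew_pulse_def by linarith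
  moreover have "(skew_pulse has_real_derivative skew_pulse_deriv s) (at s)" for s
    unfolding skew_pulse_def[abs_def] skew_pulse_deriv_def
    by (intro DERIV_diff DERIV_cdivide DERIV_chain2[OF bump_has_derivative])
      (auto intro!: derivative_eq_intros)
  moreover have "continuous_on UNIV skew_pulse_deriv"
    unfolding skew_pulse_deriv_def[abs_def]
    by (intro continuous_intros continuous_on_compose2[OF continuous_bump_deriv[of UNIV]]) auto
  ultimately show ?thesis
    unfolding control_shape_def by (auto simp: skew_pulse_def skew_pulse_deriv_def bump_eq_0)
qed

text \<open>The two teeth have disjoint supports, so the power of the sum is the sum of the powers, and each
tooth is an affine image of the bump. The factor vanishes for \<open>n = 1\<close> and is positive for odd
\<open>n \<ge> 3\<close>.\<close>

lemma has_integral_skew_pulse_power: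
  assumes "n \<ge> 1"
  shows "((\<lambda>s. skew_pulse s ^ n) has_integral
     (1 + 2 * (-1/2) ^ n) / 3 * integral {0..1} (\<lambda>s. bump s ^ n)) {0..1}"
proof -
  let ?I = "integral {0..1} (\<lambda>s. bump s ^ n)"
  have "((\<lambda>s. bump s ^ n) has_integral ?I) (cbox 0 1)"
    by (simp add: integrable_integral integrable_continuous_interval continuous_intros continuous_bump)
  note I = has_integral_affinity[OF this]
  have "((\<lambda>s. bump (3 * s) ^ n) has_integral (1/3) * ?I) {0..1/3}"
    using I[of 3 0] by simp
  then have 1: "((\<lambda>s. skew_pulse s ^ n) has_integral (1/3) * ?I) {0..1/3}"
    by (rule has_integral_eq[rotated]) (auto simp: skew_pulse_def bump_eq_0)
  have "((\<lambda>s. bump (3/2 * s + (-1/2)) ^ n) has_integral (2/3) * ?I) {1/3..1}"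
    using I[of "3/2" "-1/2"] image_affinity_atLeastAtMost[of "2/3" "1/3" 0 "1::real"] by simp
  then have "((\<lambda>s. (-1/2)^n * bump (3/2 * s + (-1/2)) ^ n) has_integral (-1/2)^n * ((2/3) * ?I)) {1/3..1}"
    by (rule has_integral_mult_right)
  then have 2: "((\<lambda>s. skew_pulse s ^ n) has_integral (-1/2)^n * ((2/3) * ?I)) {1/3..1}"
  proof (rule has_integral_eq[rotated])
    fix s :: real assume s: "s \<in> {1/3..1}"
    have "skew_pulse s = (-1/2) * bump (3/2 * s + (-1/2))"
      using s bump_eq_0[of "3 * s"] by (simp add: skew_pulse_def diff_divide_distrib)
    then show "(-1/2)^n * bump (3/2 * s + (-1/2)) ^ n = skew_pulse s ^ n"
      by (simp only: power_mult_distrib)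
  qed
  have "((\<lambda>s. skew_pulse s ^ n) has_integral (1/3) * ?I + (-1/2)^n * ((2/3) * ?I)) {0..1}"
    by (rule has_integral_combine[OF _ _ 1 2]) auto
  then show ?thesis by (simp add: field_simps)
qed

lemma integral_skew_pulse: "integral {0..1} skew_pulse = 0"
  using has_integral_skew_pulse_power[of 1] by (simp add: integral_unique)

lemma integral_skew_pulse_power_pos:
  assumes "L \<ge> 3" "odd L" shows "integral {0..1} (\<lambda>s. skew_pulse s ^ L) > 0"
proof -
  have "(1/2::real) ^ L \<le> (1/2) ^ 3" using assms by (intro power_decreasing) auto
  moreover have "(-1/2::real) ^ L = - ((1/2) ^ L)"
    using power_minus_odd[OF assms(2), of "1/2 :: real"] by simp
  ultimately have "1 + 2 * (-1/2::real) ^ L > 0" by (simp add: power3_eq_cube)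
  then show ?thesis
    using has_integral_skew_pulse_power[of L] integral_bump_power_pos[of L] assms(1)
    by (simp add: integral_unique)
qed

section \<open>Sampled-data trajectories from single intervals\<close>

definition segment_solution ::
    "(real ^ 'n \<Rightarrow> real ^ 'm \<Rightarrow> real ^ 'n) \<Rightarrow> (real \<Rightarrow> real ^ 'm) \<Rightarrow> real \<Rightarrow> real \<Rightarrow> real ^ 'n \<Rightarrow>
     (real \<Rightarrow> real ^ 'n) \<Rightarrow> bool" where
  "segment_solution F v t0 t1 \<xi> X \<longleftrightarrow>
     (\<forall>t\<in>{t0..t1}. (\<lambda>s. F (X s) (v s)) absolutely_integrable_on {t0..t} \<and>
        X t = \<xi> + integral {t0..t} (\<lambda>s. F (X s) (v s)))"

lemma segment_solution_cong:
  assumes "\<And>s. s \<in> {t0..t1} \<Longrightarrow> X s = Y s"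
    and "\<And>s. s \<in> {t0..t1} \<Longrightarrow> F (X s) (v s) = G (Y s) (w s)"
  shows "segment_solution F v t0 t1 \<xi> X \<longleftrightarrow> segment_solution G w t0 t1 \<xi> Y"
  unfolding segment_solution_def
proof (rule ball_cong[OF refl])
  fix t assume t: "t \<in> {t0..t1}"
  have *: "F (X s) (v s) = G (Y s) (w s)" if "s \<in> {t0..t}" for s using assms(2) that t by auto
  have "(\<lambda>s. F (X s) (v s)) absolutely_integrable_on {t0..t} \<longleftrightarrow>
      (\<lambda>s. G (Y s) (w s)) absolutely_integrable_on {t0..t}"
    by (intro set_integrable_cong) (use * in auto)
  moreover have "integral {t0..t} (\<lambda>s. F (X s) (v s)) = integral {t0..t} (\<lambda>s. G (Y s) (w s))"
    using * by (rule Henstock_Kurzweil_Integration.integral_cong)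
  ultimately show "((\<lambda>s. F (X s) (v s)) absolutely_integrable_on {t0..t} \<and>
        X t = \<xi> + integral {t0..t} (\<lambda>s. F (X s) (v s))) \<longleftrightarrow>
      ((\<lambda>s. G (Y s) (w s)) absolutely_integrable_on {t0..t} \<and>
        Y t = \<xi> + integral {t0..t} (\<lambda>s. G (Y s) (w s)))"
    using assms(1)[OF t] by simp
qed

text \<open>A sampling time \<open>T (Suc i)\<close> is assigned to the interval that it ends, so that the index of
\<open>T 0\<close> is \<open>0\<close>, like that of all points of the first interval.\<close>

definition sample_index :: "(nat \<Rightarrow> real) \<Rightarrow> real \<Rightarrow> nat" where
  "sample_index T t = (LEAST i. t \<le> T (Suc i))"

lemma sample_index_bound:
  assumes "sampling_partition T"
  shows "t \<le> T (Suc (sample_index T t))"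
proof -
  have "\<forall>\<^sub>F n in sequentially. t \<le> T n"
    using assms by (simp add: sampling_partition_def filterlim_at_top)
  then obtain N where "\<forall>n\<ge>N. t \<le> T n" by (auto simp: eventually_sequentially)
  then have "t \<le> T (Suc N)" by simp
  then show ?thesis unfolding sample_index_def by (rule LeastI)
qed

lemma sample_index_eq:
  assumes "sampling_partition T" and "t \<le> T (Suc i)" and "i = 0 \<or> T i < t"
  shows "sample_index T t = i"
  unfolding sample_index_def
proof (rule Least_equality)
  have mono: "strict_mono T" using assms(1) by (simp add: sampling_partition_def)
  fix j assume j: "t \<le> T (Suc j)"
  show "i \<le> j"
  proof (cases "i = 0")
    case False
    then have "T i < T (Suc j)" using assms(3) j by simp
    then show ?thesis using mono by (simp add: strict_mono_less)
  qed simp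
qed fact

text \<open>The second case is the common end point of two intervals.\<close>

lemma sample_index_cases:
  assumes "sampling_partition T" and "t \<in> {T i..T (Suc i)}"
  obtains "sample_index T t = i" | j where "i = Suc j" "t = T i" "sample_index T t = j"
proof (cases "i = 0 \<or> T i < t")
  case True
  then show thesis using sample_index_eq[OF assms(1), of t i] assms(2) that(1) by simp
next
  case False
  then obtain j where j: "i = Suc j" "t = T (Suc j)" using assms(2) by (cases i) auto
  have "T j < t" using assms(1) j by (simp add: sampling_partition_def strict_mono_less)
  then show thesis using sample_index_eq[OF assms(1), of t j] j that(2) by simp
qed

lemma sample_index_at_start:
  assumes "sampling_partition T" and "t \<ge> 0"
  shows "t \<in> {T (sample_index T t)..T (Suc (sample_index T t))}"
proof (cases "sample_index T t")
  case 0
  then show ?thesis using sample_index_bound[OF assms(1), of t] assms by (simp add: sampling_partition_def)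
next
  case (Suc j)
  then have "\<not> t \<le> T (Suc j)" unfolding sample_index_def using not_less_Least by (metis lessI)
  then show ?thesis using Suc sample_index_bound[OF assms(1), of t] by simp
qed

text \<open>Measurability follows from the measurability of the index, which takes countably many values; on a
compact set only finitely many pieces occur, which gives boundedness.\<close>

lemma admissible_piecewise_feedback:
  fixes U :: "nat \<Rightarrow> real \<Rightarrow> real ^ 'n \<Rightarrow> real ^ 'm"
  assumes T: "sampling_partition T"
    and cont: "\<And>i \<xi>. continuous_on UNIV (\<lambda>t. U i t \<xi>)"
  shows "admissible_feedback D (\<lambda>t \<xi>. U (sample_index T t) t \<xi>)"
  unfolding admissible_feedback_def
proof (intro ballI conjI)
  fix \<xi>
  have idx: "sample_index T \<in> measurable borel (count_space UNIV)"
    unfolding sample_index_def[abs_def] by (rule measurable_Least) simp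
  have "(\<lambda>t. U (sample_index T t) t \<xi>) \<in> borel_measurable borel"
    using borel_measurable_continuous_onI[OF cont] idx
    by (rule measurable_compose_countable[where f = "\<lambda>i t. U i t \<xi>" and g = "sample_index T"])
  then have "(\<lambda>t. U (sample_index T t) t \<xi>) \<in> borel_measurable lebesgue"
    by (simp add: measurable_completion)
  then show "(\<lambda>t. U (sample_index T t) t \<xi>) \<in> borel_measurable (lebesgue_on {0..})"
    by (rule measurable_restrict_space1)
  show "locally_ess_bounded (\<lambda>t. U (sample_index T t) t \<xi>)"
    unfolding locally_ess_bounded_def
  proof (intro allI impI)
    fix K :: "real set" assume K: "compact K \<and> K \<subseteq> {0..}"
    then have "bdd_above K" by (intro bounded_imp_bdd_above compact_imp_bounded) simp
    then obtain c where c: "\<And>t. t \<in> K \<Longrightarrow> t \<le> c" by (auto simp: bdd_above_def)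
    have "\<exists>B. \<forall>t\<in>K. norm (U i t \<xi>) \<le> B" for i
    proof -
      have "continuous_on K (\<lambda>t. U i t \<xi>)" using cont by (rule continuous_on_subset) simp
      then obtain B where "\<And>t. t \<in> K \<Longrightarrow> norm (U i t \<xi>) \<le> B"
        using K continuous_on_compact_bound by blast
      then show ?thesis by blast
    qed
    then obtain B where B: "\<And>i t. t \<in> K \<Longrightarrow> norm (U i t \<xi>) \<le> B i" by metis
    have le: "sample_index T t \<le> sample_index T c" if "t \<in> K" for t
      unfolding sample_index_def[of T t]
      using c[OF that] sample_index_bound[OF T, of c] by (intro Least_le) simp
    have "norm (U (sample_index T t) t \<xi>) \<le> Max (B ` {..sample_index T c})" if "t \<in> K" for t
    proof -
      have "norm (U (sample_index T t) t \<xi>) \<le> B (sample_index T t)" using B that by blast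
      also have "\<dots> \<le> Max (B ` {..sample_index T c})" using le[OF that] by (intro Max_ge) auto
      finally show ?thesis .
    qed
    then show "\<exists>C. AE t in lebesgue_on K. norm (U (sample_index T t) t \<xi>) \<le> C"
      by (intro exI AE_I2) (auto simp: space_restrict_space)
  qed
qed

lemma sampled_data_trajectory_segments:
  "sampled_data_trajectory F T D k x \<longleftrightarrow>
     (\<forall>i. x (T i) \<in> D \<and>
       segment_solution F (\<lambda>s. k s (x (T i))) (T i) (T (Suc i)) (x (T i)) x)"
  by (simp add: sampled_data_trajectory_def segment_solution_def)

text \<open>Solutions on the single intervals that end in \<open>D\<close> can be continued on the next interval. The end
state of each interval is the start state of the next one, so the pieces agree at the
sampling times.\<close>

lemma sampled_data_trajectory_exists:
  fixes F :: "real ^ 'n \<Rightarrow> real ^ 'm \<Rightarrow> real ^ 'n"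
  assumes T: "sampling_partition T" and x0: "x0 \<in> D"
    and seg: "\<And>i \<xi>. \<xi> \<in> D \<Longrightarrow>
      \<exists>X. segment_solution F (\<lambda>s. k s \<xi>) (T i) (T (Suc i)) \<xi> X \<and> X (T (Suc i)) \<in> D"
  shows "\<exists>x. sampled_data_trajectory F T D k x \<and> x 0 = x0"
proof -
  define S where "S i \<xi> = (SOME X. segment_solution F (\<lambda>s. k s \<xi>) (T i) (T (Suc i)) \<xi> X \<and>
      X (T (Suc i)) \<in> D)" for i \<xi>
  have S: "segment_solution F (\<lambda>s. k s \<xi>) (T i) (T (Suc i)) \<xi> (S i \<xi>)"
    and SD: "S i \<xi> (T (Suc i)) \<in> D" if "\<xi> \<in> D" for i \<xi>
    using someI_ex[OF seg[OF that, of i]] by (simp_all add: S_def)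
  have mono: "T i < T (Suc i)" for i using T by (simp add: sampling_partition_def strict_mono_less)
  have start: "S i \<xi> (T i) = \<xi>" if "\<xi> \<in> D" for i \<xi>
    using S[OF that, of i] mono[of i] unfolding segment_solution_def by (auto dest!: bspec[of _ _ "T i"])
  define z where "z = rec_nat x0 (\<lambda>i \<xi>. S i \<xi> (T (Suc i)))"
  have z0: "z 0 = x0" and zS: "z (Suc i) = S i (z i) (T (Suc i))" for i by (simp_all add: z_def)
  have zD: "z i \<in> D" for i by (induction i) (simp_all add: z0 zS x0 SD)
  define x where "x t = S (sample_index T t) (z (sample_index T t)) t" for t
  have x: "x t = S i (z i) t" if t: "t \<in> {T i..T (Suc i)}" for i t
    using T t
  proof (cases rule: sample_index_cases)
    case 1
    then show ?thesis by (simp add: x_def)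
  next
    case (2 j)
    then show ?thesis using zS[of j] start[OF zD, of i i] by (simp add: x_def)
  qed
  have xT: "x (T i) = z i" for i using x[of "T i" i] mono[of i] start[OF zD] by simp
  have "sampled_data_trajectory F T D k x"
    unfolding sampled_data_trajectory_segments
  proof (intro allI conjI)
    fix i
    show "x (T i) \<in> D" by (simp add: xT zD)
    have "segment_solution F (\<lambda>s. k s (z i)) (T i) (T (Suc i)) (z i) x \<longleftrightarrow>
        segment_solution F (\<lambda>s. k s (z i)) (T i) (T (Suc i)) (z i) (S i (z i))"
      using x by (intro segment_solution_cong) simp_all
    then show "segment_solution F (\<lambda>s. k s (x (T i))) (T i) (T (Suc i)) (x (T i)) x"
      using S[OF zD] by (simp add: xT)
  qed
  moreover have "x 0 = x0" using xT[of 0] T z0 by (simp add: sampling_partition_def)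
  ultimately show ?thesis by blast
qed

section \<open>Response of the system to one pulse\<close>

definition cascade :: "(real ^ 3 \<Rightarrow> real) \<Rightarrow> (real ^ 3 \<Rightarrow> real) \<Rightarrow> nat \<Rightarrow> real ^ 3 \<Rightarrow> real ^ 1 \<Rightarrow> real ^ 3" where
  "cascade a b L x u = vector [a x * (x $ 3) ^ L, b x * (x $ 3), u $ 1]"

lemma cascade_component [simp]:
  "cascade a b L x u $ 1 = a x * (x $ 3) ^ L" 
  "cascade a b L x u $ 2 = b x * (x $ 3)"
  "cascade a b L x u $ 3 = u $ 1"
  by (simp_all add: cascade_def)

definition pulse_control :: "real \<Rightarrow> real \<Rightarrow> (real \<Rightarrow> real) \<Rightarrow> real \<Rightarrow> real \<Rightarrow> real ^ 1" where
  "pulse_control A h \<phi>' t0 s = vec (A / h * \<phi>' ((s - t0) / h))"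

definition bounded_lipschitz_on :: "'a::real_normed_vector set \<Rightarrow> real \<Rightarrow> ('a \<Rightarrow> real) \<Rightarrow> bool" where
  "bounded_lipschitz_on S Q g \<longleftrightarrow>
     (\<forall>z\<in>S. \<bar>g z\<bar> \<le> Q) \<and> (\<forall>z\<in>S. \<forall>w\<in>S. \<bar>g z - g w\<bar> \<le> Q * norm (z - w))"

lemma norm_vec3_le: "norm (x :: real ^ 3) \<le> \<bar>x $ 1\<bar> + \<bar>x $ 2\<bar> + \<bar>x $ 3\<bar>"
  using norm_le_l1_cart[of x] by (simp add: sum_3)

text \<open>A pulse of shape \<open>\<phi>\<close> and amplitude \<open>A\<close> in the window from \<open>t0\<close> to \<open>t0 + h\<close>, applied at state
\<open>\<xi>\<close>. The bound on \<open>h\<close> keeps the displacement of the first two states below \<open>1 / 8\<close>; with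
\<open>norm \<xi> \<le> \<rho>\<close> and \<open>\<bar>A\<bar> \<le> \<rho>\<close> the state then remains in the ball of radius \<open>5 * \<rho>\<close>, where
the coefficients are controlled.\<close>

locale pulse =
  fixes a b :: "real ^ 3 \<Rightarrow> real" and L :: nat and Q \<rho> :: real
    and \<phi> \<phi>' :: "real \<Rightarrow> real" and A h t0 t1 :: real and \<xi> :: "real ^ 3"
  assumes L: "L \<ge> 1" and Q: "Q \<ge> 1" and \<rho>: "\<rho> \<ge> 1"
    and a: "bounded_lipschitz_on (cball 0 (5 * \<rho>)) Q a"
    and b: "bounded_lipschitz_on (cball 0 (5 * \<rho>)) Q b"
    and shape: "control_shape \<phi> \<phi>'" and A: "\<bar>A\<bar> \<le> \<rho>" and start: "A * \<phi> 0 = \<xi> $ 3"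
    and \<xi>: "norm \<xi> \<le> \<rho>" and h: "h > 0" "8 * Q * \<rho> ^ L * h \<le> 1" and t1: "t0 + h \<le> t1"
begin

definition y :: "real \<Rightarrow> real" where "y s = A * \<phi> ((s - t0) / h)"
definition u :: "real \<Rightarrow> real" where "u s = A / h * \<phi>' ((s - t0) / h)"

lemma y_has_derivative: "(y has_real_derivative u s) (at s)"
proof -
  have "(\<phi> has_real_derivative \<phi>' ((s - t0) / h)) (at ((s - t0) / h))"
    using shape by (simp add: control_shape_def)
  moreover have "((\<lambda>s. (s - t0) / h) has_real_derivative 1 / h) (at s)"
    using h(1) by (auto intro!: derivative_eq_intros)
  ultimately have "((\<lambda>s. \<phi> ((s - t0) / h)) has_real_derivative \<phi>' ((s - t0) / h) * (1 / h)) (at s)"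
    by (rule DERIV_chain2)
  then have "((\<lambda>s. A * \<phi> ((s - t0) / h)) has_real_derivative A * (\<phi>' ((s - t0) / h) * (1 / h))) (at s)"
    by (rule DERIV_cmult)
  then show ?thesis unfolding y_def[abs_def] u_def by simp
qed

lemma continuous_y: "continuous_on S y"
  by (intro continuous_at_imp_continuous_on ballI DERIV_isCont[OF y_has_derivative])

lemma continuous_u: "continuous_on S u"
proof -
  have "continuous_on UNIV \<phi>'" using shape by (simp add: control_shape_def)
  then have "continuous_on S (\<lambda>s. \<phi>' ((s - t0) / h))"
    by (rule continuous_on_compose2) (use h(1) in \<open>auto intro!: continuous_intros\<close>)
  then show ?thesis unfolding u_def[abs_def] by (rule continuous_on_mult_left)
qed

lemma y_bound: "s \<ge> t0 \<Longrightarrow> \<bar>y s\<bar> \<le> \<bar>A\<bar>"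
  using shape h(1) mult_left_le[of "\<bar>\<phi> ((s - t0) / h)\<bar>" "\<bar>A\<bar>"]
  by (auto simp: y_def abs_mult control_shape_def)

lemma y_after: "s \<ge> t0 + h \<Longrightarrow> y s = 0" and u_after: "s \<ge> t0 + h \<Longrightarrow> u s = 0"
  using shape h(1) by (simp_all add: y_def u_def control_shape_def le_divide_eq)

lemma y_start: "y t0 = \<xi> $ 3" using start by (simp add: y_def)

lemma integral_u: "t \<ge> t0 \<Longrightarrow> (u has_integral y t - \<xi> $ 3) {t0..t}"
  unfolding y_start[symmetric]
  by (rule fundamental_theorem_of_calculus)
    (auto simp: has_real_derivative_iff_has_vector_derivative[symmetric]
      intro: y_has_derivative has_field_derivative_at_within)

lemma power_A_bound: "1 \<le> n \<Longrightarrow> n \<le> L \<Longrightarrow> Q * \<bar>A\<bar> ^ n * h \<le> \<bar>A\<bar> / 8"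
  and gain_bound: "1 \<le> n \<Longrightarrow> n \<le> L \<Longrightarrow> Q * \<bar>A\<bar> ^ n * h \<le> 1 / 8"
proof -
  assume n: "1 \<le> n" "n \<le> L"
  have "\<bar>A\<bar> ^ (n - 1) \<le> \<rho> ^ (n - 1)" using A by (intro power_mono) auto
  also have "\<dots> \<le> \<rho> ^ L" using n \<rho> by (intro power_increasing) auto
  finally have "Q * h * \<bar>A\<bar> ^ (n - 1) \<le> Q * h * \<rho> ^ L" using Q h(1) by (intro mult_left_mono) auto
  also have "\<dots> \<le> 1 / 8" using h(2) by (simp add: mult_ac)
  finally have "\<bar>A\<bar> * (Q * h * \<bar>A\<bar> ^ (n - 1)) \<le> \<bar>A\<bar> * (1 / 8)" by (intro mult_left_mono) auto
  moreover have "\<bar>A\<bar> ^ n = \<bar>A\<bar> * \<bar>A\<bar> ^ (n - 1)" using n by (simp add: power_eq_if)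
  ultimately show "Q * \<bar>A\<bar> ^ n * h \<le> \<bar>A\<bar> / 8" by (simp add: mult_ac)
  have "\<bar>A\<bar> ^ n \<le> \<rho> ^ n" using A by (intro power_mono) auto
  also have "\<dots> \<le> \<rho> ^ L" using n \<rho> by (intro power_increasing) auto
  finally have "Q * h * \<bar>A\<bar> ^ n \<le> Q * h * \<rho> ^ L" using Q h(1) by (intro mult_left_mono) auto
  also have "\<dots> \<le> 1 / 8" using h(2) by (simp add: mult_ac)
  finally show "Q * \<bar>A\<bar> ^ n * h \<le> 1 / 8" by (simp add: mult_ac)
qed

context
  fixes X :: "real \<Rightarrow> real ^ 3"
  assumes sol: "segment_solution (cascade a b L) (pulse_control A h \<phi>' t0) t0 t1 \<xi> X"
begin

lemma component_integrable:
    "t \<in> {t0..t1} \<Longrightarrow> (\<lambda>s. cascade a b L (X s) (pulse_control A h \<phi>' t0 s) $ j) integrable_on {t0..t}"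
  and component_eq:
    "t \<in> {t0..t1} \<Longrightarrow>
      X t $ j = \<xi> $ j + integral {t0..t} (\<lambda>s. cascade a b L (X s) (pulse_control A h \<phi>' t0 s) $ j)"
proof -
  assume t: "t \<in> {t0..t1}"
  let ?f = "\<lambda>s. cascade a b L (X s) (pulse_control A h \<phi>' t0 s)"
  have int: "?f integrable_on {t0..t}" and X: "X t = \<xi> + integral {t0..t} ?f"
    using sol t by (simp_all add: segment_solution_def set_lebesgue_integral_eq_integral(1))
  show "(\<lambda>s. ?f s $ j) integrable_on {t0..t}"
    using integrable_linear[OF int bounded_linear_vec_nth] by (simp add: o_def)
  show "X t $ j = \<xi> $ j + integral {t0..t} (\<lambda>s. ?f s $ j)"
    using int by (subst X) simp
qed

lemma X3: "t \<in> {t0..t1} \<Longrightarrow> X t $ 3 = y t"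
  using component_eq[of t 3] integral_unique[OF integral_u, of t]
  by (simp add: pulse_control_def u_def[abs_def])

lemma rate_integrable:
    "t \<in> {t0..t1} \<Longrightarrow> (\<lambda>s. a (X s) * y s ^ L) integrable_on {t0..t}"
    "t \<in> {t0..t1} \<Longrightarrow> (\<lambda>s. b (X s) * y s ^ 1) integrable_on {t0..t}"
  and X1: "t \<in> {t0..t1} \<Longrightarrow> X t $ 1 = \<xi> $ 1 + integral {t0..t} (\<lambda>s. a (X s) * y s ^ L)"
  and X2: "t \<in> {t0..t1} \<Longrightarrow> X t $ 2 = \<xi> $ 2 + integral {t0..t} (\<lambda>s. b (X s) * y s ^ 1)"
proof -
  assume t: "t \<in> {t0..t1}"
  have *: "X s $ 3 = y s" if "s \<in> {t0..t}" for s using t that by (intro X3) auto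
  show "(\<lambda>s. a (X s) * y s ^ L) integrable_on {t0..t}"
    by (rule integrable_eq[OF component_integrable[OF t, of 1]]) (simp add: *)
  show "(\<lambda>s. b (X s) * y s ^ 1) integrable_on {t0..t}"
    by (rule integrable_eq[OF component_integrable[OF t, of 2]]) (simp add: *)
  show "X t $ 1 = \<xi> $ 1 + integral {t0..t} (\<lambda>s. a (X s) * y s ^ L)"
    unfolding component_eq[OF t, of 1]
    by (intro arg_cong2[of _ _ _ _ "(+)"] refl Henstock_Kurzweil_Integration.integral_cong) (simp add: *)
  show "X t $ 2 = \<xi> $ 2 + integral {t0..t} (\<lambda>s. b (X s) * y s ^ 1)"
    unfolding component_eq[OF t, of 2]
    by (intro arg_cong2[of _ _ _ _ "(+)"] refl Henstock_Kurzweil_Integration.integral_cong) (simp add: *)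
qed

text \<open>The third state rests at zero after the window, so the drift is switched off.\<close>

lemma rate_integral_after:
  assumes int: "(\<lambda>s. g (X s) * y s ^ n) integrable_on {t0..t}" and n: "n \<ge> 1" and t: "t0 + h \<le> t"
  shows "integral {t0..t} (\<lambda>s. g (X s) * y s ^ n) = integral {t0..t0 + h} (\<lambda>s. g (X s) * y s ^ n)"
proof -
  have "integral {t0..t} (\<lambda>s. g (X s) * y s ^ n) =
      integral {t0..t0 + h} (\<lambda>s. g (X s) * y s ^ n) + integral {t0 + h..t} (\<lambda>s. g (X s) * y s ^ n)"
    using t h(1) int by (intro Henstock_Kurzweil_Integration.integral_combine[symmetric]) auto
  moreover have "integral {t0 + h..t} (\<lambda>s. g (X s) * y s ^ n) = integral {t0 + h..t} (\<lambda>s. 0)"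
    using n by (intro Henstock_Kurzweil_Integration.integral_cong) (simp add: y_after)
  ultimately show ?thesis by simp
qed

lemma X_after:
  assumes "t \<in> {t0 + h..t1}" shows "X t = X (t0 + h)"
proof -
  have t: "t \<in> {t0..t1}" "t0 + h \<in> {t0..t1}" "t0 + h \<le> t" using assms h(1) by auto
  have "X t $ 1 = X (t0 + h) $ 1"
    unfolding X1[OF t(1)] X1[OF t(2)]
    using rate_integral_after[OF rate_integrable(1)[OF t(1)] L t(3)] by simp
  moreover have "X t $ 2 = X (t0 + h) $ 2"
    unfolding X2[OF t(1)] X2[OF t(2)]
    using rate_integral_after[OF rate_integrable(2)[OF t(1)] _ t(3)] by simp
  moreover have "X t $ 3 = X (t0 + h) $ 3" using X3 t y_after by simp
  ultimately show ?thesis by (simp add: vec_eq_iff forall_3)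
qed

lemma rate_integral_bound:
  assumes int: "(\<lambda>s. g (X s) * y s ^ n) integrable_on {t0..t}" and t: "t \<in> {t0..t0 + h}"
    and g: "\<And>s. s \<in> {t0..t} \<Longrightarrow> \<bar>g (X s)\<bar> \<le> C"
  shows "\<bar>integral {t0..t} (\<lambda>s. g (X s) * y s ^ n)\<bar> \<le> C * \<bar>A\<bar> ^ n * h"
proof -
  have C: "C \<ge> 0" using g[of t0] t by force
  have "norm (integral {t0..t} (\<lambda>s. g (X s) * y s ^ n)) \<le> integral {t0..t} (\<lambda>s. C * \<bar>A\<bar> ^ n)"
  proof (rule integral_norm_bound_integral[OF int])
    fix s assume s: "s \<in> {t0..t}"
    have "\<bar>g (X s)\<bar> * \<bar>y s\<bar> ^ n \<le> C * \<bar>A\<bar> ^ n"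
      using s g[OF s] y_bound[of s] C by (intro mult_mono power_mono) auto
    then show "norm (g (X s) * y s ^ n) \<le> C * \<bar>A\<bar> ^ n" by (simp add: abs_mult power_abs)
  qed (rule integrable_const_ivl)
  also have "\<dots> = C * \<bar>A\<bar> ^ n * (t - t0)" using t by (simp add: mult.commute)
  also have "\<dots> \<le> C * \<bar>A\<bar> ^ n * h" using t C by (intro mult_left_mono) auto
  finally show ?thesis by simp
qed

text \<open>The a-priori estimate: while the first two states are within \<open>1\<close> of their start, the state is in
the ball of radius \<open>5 * \<rho>\<close> and the coefficients are bounded by \<open>Q\<close>.\<close>

lemma displacement_in_region:
  assumes t: "t \<in> {t0..t0 + h}"
    and near: "\<And>s. s \<in> {t0..t} \<Longrightarrow> max \<bar>X s $ 1 - \<xi> $ 1\<bar> \<bar>X s $ 2 - \<xi> $ 2\<bar> \<le> 1"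
  shows "X t \<in> cball 0 (5 * \<rho>)"
    and "\<bar>X t $ 1 - \<xi> $ 1\<bar> \<le> Q * \<bar>A\<bar> ^ L * h"
    and "\<bar>X t $ 2 - \<xi> $ 2\<bar> \<le> Q * \<bar>A\<bar> * h"
proof -
  have t01: "t \<in> {t0..t1}" using t t1 by auto
  have in_ball: "X s \<in> cball 0 (5 * \<rho>)" if s: "s \<in> {t0..t}" for s
  proof -
    have "\<bar>X s $ 3\<bar> \<le> \<rho>" using X3[of s] y_bound[of s] A s t01 by auto
    moreover have "\<bar>\<xi> $ 1\<bar> \<le> \<rho>" "\<bar>\<xi> $ 2\<bar> \<le> \<rho>"
      using \<xi> component_le_norm_cart[of \<xi>] order_trans by blast+
    ultimately have "norm (X s) \<le> 5 * \<rho>"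
      using near[OF s] norm_vec3_le[of "X s"] \<rho> by linarith
    then show ?thesis by simp
  qed
  then show "X t \<in> cball 0 (5 * \<rho>)" using t by simp
  have "\<bar>a (X s)\<bar> \<le> Q" "\<bar>b (X s)\<bar> \<le> Q" if "s \<in> {t0..t}" for s
    using in_ball[OF that] a b by (auto simp: bounded_lipschitz_on_def)
  then show "\<bar>X t $ 1 - \<xi> $ 1\<bar> \<le> Q * \<bar>A\<bar> ^ L * h" "\<bar>X t $ 2 - \<xi> $ 2\<bar> \<le> Q * \<bar>A\<bar> * h"
    using rate_integral_bound[OF rate_integrable(1)[OF t01] t, of Q]
      rate_integral_bound[OF rate_integrable(2)[OF t01] t, of Q] X1[OF t01] X2[OF t01]
    by simp_all
qed

text \<open>The displacement estimated under the assumption that it is at most \<open>1\<close> is at most \<open>1 / 8\<close>, so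
the assumption can be removed.\<close>

lemma near_start:
  assumes t: "t \<in> {t0..t0 + h}"
  shows "max \<bar>X t $ 1 - \<xi> $ 1\<bar> \<bar>X t $ 2 - \<xi> $ 2\<bar> \<le> 1 / 8"
proof (rule first_exit_bootstrap[where a = t0 and b = "t0 + h" and d = 1 and c = "1/8" and
      f = "\<lambda>t. max \<bar>X t $ 1 - \<xi> $ 1\<bar> \<bar>X t $ 2 - \<xi> $ 2\<bar>"])
  have th: "t0 + h \<in> {t0..t1}" using h(1) t1 by auto
  have c1: "continuous_on {t0..t0 + h} (\<lambda>t. \<xi> $ 1 + integral {t0..t} (\<lambda>s. a (X s) * y s ^ L))"
    and c2: "continuous_on {t0..t0 + h} (\<lambda>t. \<xi> $ 2 + integral {t0..t} (\<lambda>s. b (X s) * y s ^ 1))"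
    by (intro continuous_intros indefinite_integral_continuous_1 rate_integrable th)+
  have "continuous_on {t0..t0 + h} (\<lambda>t. X t $ 1)"
    by (rule continuous_on_eq[OF c1]) (use X1 t1 in auto)
  moreover have "continuous_on {t0..t0 + h} (\<lambda>t. X t $ 2)"
    by (rule continuous_on_eq[OF c2]) (use X2 t1 in auto)
  ultimately show "continuous_on {t0..t0 + h} (\<lambda>t. max \<bar>X t $ 1 - \<xi> $ 1\<bar> \<bar>X t $ 2 - \<xi> $ 2\<bar>)"
    by (intro continuous_on_max continuous_on_rabs continuous_on_diff continuous_on_const)
  show "max \<bar>X t0 $ 1 - \<xi> $ 1\<bar> \<bar>X t0 $ 2 - \<xi> $ 2\<bar> \<le> 1 / 8"
    using X1[of t0] X2[of t0] h(1) t1 by simp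
  show "max \<bar>X s $ 1 - \<xi> $ 1\<bar> \<bar>X s $ 2 - \<xi> $ 2\<bar> \<le> 1 / 8"
    if "s \<in> {t0..t0 + h}" "\<And>r. r \<in> {t0..s} \<Longrightarrow> max \<bar>X r $ 1 - \<xi> $ 1\<bar> \<bar>X r $ 2 - \<xi> $ 2\<bar> \<le> 1" for s
    using displacement_in_region(2,3)[OF that] gain_bound[OF L order_refl] gain_bound[OF order_refl L]
    unfolding power_one_right by (intro max.boundedI; linarith)
qed (use t in auto)

lemma displacement_window:
  assumes "t \<in> {t0..t0 + h}"
  shows "X t \<in> cball 0 (5 * \<rho>)"
    and "\<bar>X t $ 1 - \<xi> $ 1\<bar> \<le> Q * \<bar>A\<bar> ^ L * h"
    and "\<bar>X t $ 2 - \<xi> $ 2\<bar> \<le> Q * \<bar>A\<bar> * h"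
proof -
  have "max \<bar>X s $ 1 - \<xi> $ 1\<bar> \<bar>X s $ 2 - \<xi> $ 2\<bar> \<le> 1" if "s \<in> {t0..t}" for s
    using order_trans[OF near_start[of s], of 1] that assms by simp
  from displacement_in_region[OF assms this] 
  show "X t \<in> cball 0 (5 * \<rho>)"
    and "\<bar>X t $ 1 - \<xi> $ 1\<bar> \<le> Q * \<bar>A\<bar> ^ L * h"
    and "\<bar>X t $ 2 - \<xi> $ 2\<bar> \<le> Q * \<bar>A\<bar> * h" by blast+
qed

lemma displacement:
  assumes "t \<in> {t0..t1}"
  shows "X t \<in> cball 0 (5 * \<rho>)"
    and "\<bar>X t $ 1 - \<xi> $ 1\<bar> \<le> Q * \<bar>A\<bar> ^ L * h"
    and "\<bar>X t $ 2 - \<xi> $ 2\<bar> \<le> Q * \<bar>A\<bar> * h"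
    and "\<bar>X t $ 3\<bar> \<le> \<bar>A\<bar>"
proof -
  obtain r where r: "r \<in> {t0..t0 + h}" "X t = X r"
  proof (cases "t \<le> t0 + h")
    case True
    then show thesis using assms that[of t] by simp
  next
    case False
    then show thesis using assms that[of "t0 + h", OF _ X_after] h(1) by simp
  qed
  show "X t \<in> cball 0 (5 * \<rho>)" "\<bar>X t $ 1 - \<xi> $ 1\<bar> \<le> Q * \<bar>A\<bar> ^ L * h"
    "\<bar>X t $ 2 - \<xi> $ 2\<bar> \<le> Q * \<bar>A\<bar> * h"
    unfolding r(2) by (intro displacement_window r(1))+
  show "\<bar>X t $ 3\<bar> \<le> \<bar>A\<bar>" using X3[OF assms] y_bound[of t] assms by simp
qed

lemma displacement_from_rest:
  assumes "t \<in> {t0..t1}" and "\<xi> $ 3 = 0"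
  shows "norm (X t - \<xi>) \<le> 2 * \<bar>A\<bar>"
proof -
  have "norm (X t - \<xi>) \<le> \<bar>X t $ 1 - \<xi> $ 1\<bar> + \<bar>X t $ 2 - \<xi> $ 2\<bar> + \<bar>X t $ 3\<bar>"
    using norm_vec3_le[of "X t - \<xi>"] assms(2) by simp
  then show ?thesis
    using displacement[OF assms(1)] power_A_bound[OF L order_refl] power_A_bound[OF order_refl L]
    unfolding power_one_right by linarith
qed

lemma integral_pulse_power:
  "((\<lambda>s. y s ^ n) has_integral A ^ n * h * integral {0..1} (\<lambda>s. \<phi> s ^ n)) {t0..t0 + h}"
proof -
  have "continuous_on UNIV \<phi>"
    using shape
    by (intro continuous_at_imp_continuous_on ballI DERIV_isCont[of \<phi> "\<phi>' x" x for x])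
      (simp add: control_shape_def)
  then have "continuous_on {0..1} (\<lambda>s. \<phi> s ^ n)"
    by (intro continuous_intros) (auto intro: continuous_on_subset)
  then have "((\<lambda>s. \<phi> s ^ n) has_integral integral {0..1} (\<lambda>s. \<phi> s ^ n)) (cbox 0 1)"
    by (simp add: integrable_integral integrable_continuous_interval)
  from has_integral_affinity[OF this, of "1 / h" "- t0 / h"] h(1)
  have "((\<lambda>s. \<phi> (s / h - t0 / h) ^ n) has_integral h * integral {0..1} (\<lambda>s. \<phi> s ^ n))
      ((\<lambda>x. h * x + t0) ` {0..1})" by simp
  moreover have "(\<lambda>x. h * x + t0) ` {0..1} = {t0..t0 + h}"
    using h(1) image_affinity_atLeastAtMost[of h t0 0 1] by (simp add: add.commute)
  ultimately have "((\<lambda>s. \<phi> ((s - t0) / h) ^ n) has_integral h * integral {0..1} (\<lambda>s. \<phi> s ^ n)) {t0..t0 + h}"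
    by (simp add: diff_divide_distrib)
  from has_integral_mult_right[OF this, of "A ^ n"] show ?thesis
    unfolding y_def[abs_def] by (simp add: power_mult_distrib mult_ac)
qed

text \<open>Freezing the coefficient at \<open>\<xi>\<close> costs at most \<open>Q\<close> times the distance to \<open>\<xi>\<close>, which is at
most \<open>2 * \<bar>A\<bar>\<close>.\<close>

lemma rate_integral_expansion:
  assumes g: "bounded_lipschitz_on (cball 0 (5 * \<rho>)) Q g" and rest: "\<xi> $ 3 = 0"
    and int: "(\<lambda>s. g (X s) * y s ^ n) integrable_on {t0..t0 + h}"
  shows "\<bar>integral {t0..t0 + h} (\<lambda>s. g (X s) * y s ^ n) -
      g \<xi> * A ^ n * h * integral {0..1} (\<lambda>s. \<phi> s ^ n)\<bar> \<le> 2 * Q * \<bar>A\<bar> ^ Suc n * h"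
proof -
  have yint: "(\<lambda>s. g \<xi> * y s ^ n) integrable_on {t0..t0 + h}"
    using has_integral_mult_right[OF integral_pulse_power] by blast
  have "integral {t0..t0 + h} (\<lambda>s. g (X s) * y s ^ n) - g \<xi> * (A ^ n * h * integral {0..1} (\<lambda>s. \<phi> s ^ n)) =
      integral {t0..t0 + h} (\<lambda>s. g (X s) * y s ^ n) - integral {t0..t0 + h} (\<lambda>s. g \<xi> * y s ^ n)"
    using integral_unique[OF integral_pulse_power] by simp
  also have "\<dots> = integral {t0..t0 + h} (\<lambda>s. (g (X s) - g \<xi>) * y s ^ n)"
    using Henstock_Kurzweil_Integration.integral_diff[OF int yint] by (simp add: left_diff_distrib)
  finally have eq: "integral {t0..t0 + h} (\<lambda>s. g (X s) * y s ^ n) -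
      g \<xi> * (A ^ n * h * integral {0..1} (\<lambda>s. \<phi> s ^ n)) =
      integral {t0..t0 + h} (\<lambda>s. (g (X s) - g \<xi>) * y s ^ n)" .
  have "\<bar>integral {t0..t0 + h} (\<lambda>s. (g (X s) - g \<xi>) * y s ^ n)\<bar> \<le> (Q * (2 * \<bar>A\<bar>)) * \<bar>A\<bar> ^ n * h"
  proof (rule rate_integral_bound)
    show "(\<lambda>s. (g (X s) - g \<xi>) * y s ^ n) integrable_on {t0..t0 + h}"
      using integrable_diff[OF int yint] by (simp add: left_diff_distrib)
    fix s assume "s \<in> {t0..t0 + h}"
    then have s: "s \<in> {t0..t1}" using t1 by auto
    have "\<xi> \<in> cball 0 (5 * \<rho>)" using \<xi> \<rho> by simp
    then have "\<bar>g (X s) - g \<xi>\<bar> \<le> Q * norm (X s - \<xi>)"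
      using g displacement(1)[OF s] by (simp add: bounded_lipschitz_on_def)
    also have "\<dots> \<le> Q * (2 * \<bar>A\<bar>)"
      using displacement_from_rest[OF s rest] Q by (intro mult_left_mono) auto
    finally show "\<bar>g (X s) - g \<xi>\<bar> \<le> Q * (2 * \<bar>A\<bar>)" .
  qed (use h(1) in auto)
  then show ?thesis using eq by (simp add: mult_ac)
qed

lemma end_at_rest: "X t1 $ 3 = 0"
  using X3[of t1] y_after[OF t1] h(1) t1 by simp

lemma net_displacement:
  assumes rest: "\<xi> $ 3 = 0"
  shows "\<bar>X t1 $ 1 - \<xi> $ 1 - a \<xi> * A ^ L * h * integral {0..1} (\<lambda>s. \<phi> s ^ L)\<bar> \<le> 2 * Q * \<bar>A\<bar> ^ Suc L * h"
    and "\<bar>X t1 $ 2 - \<xi> $ 2 - b \<xi> * A * h * integral {0..1} \<phi>\<bar> \<le> 2 * Q * \<bar>A\<bar>\<^sup>2 * h"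
proof -
  have th: "t0 + h \<in> {t0..t1}" using h(1) t1 by auto
  have eq: "X t1 = X (t0 + h)" by (rule X_after) (use t1 in auto)
  show "\<bar>X t1 $ 1 - \<xi> $ 1 - a \<xi> * A ^ L * h * integral {0..1} (\<lambda>s. \<phi> s ^ L)\<bar> \<le> 2 * Q * \<bar>A\<bar> ^ Suc L * h"
    using rate_integral_expansion[OF a rest rate_integrable(1)[OF th]] unfolding eq X1[OF th] by simp
  show "\<bar>X t1 $ 2 - \<xi> $ 2 - b \<xi> * A * h * integral {0..1} \<phi>\<bar> \<le> 2 * Q * \<bar>A\<bar>\<^sup>2 * h"
    using rate_integral_expansion[OF b rest rate_integrable(2)[OF th]] unfolding eq X2[OF th]
    by (simp add: power2_eq_square)
qed

end

end

section \<open>Existence of the response\<close>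

lemma continuous_on_vector3:
  fixes f g k :: "'a::topological_space \<Rightarrow> real"
  assumes "continuous_on S f" "continuous_on S g" "continuous_on S k"
  shows "continuous_on S (\<lambda>s. vector [f s, g s, k s] :: real ^ 3)"
proof -
  have "continuous_on S (\<lambda>s. \<chi> i::3. (vector [f s, g s, k s] :: real ^ 3) $ i)"
  proof (rule continuous_on_vec_lambda)
    fix i :: 3
    show "continuous_on S (\<lambda>s. (vector [f s, g s, k s] :: real ^ 3) $ i)"
      using exhaust_3[of i] assms by auto
  qed
  then show ?thesis by simp
qed

context pulse
begin

text \<open>Composing the coefficients with the projection to the ball of radius \<open>5 * \<rho>\<close> makes them globally
bounded and Lipschitz, so Picard iteration yields a solution of the modified system. The
estimates for pulses apply to the modified system as well and keep its solution in the ball, where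
both systems agree.\<close>

lemma response_exists:
  "\<exists>X. segment_solution (cascade a b L) (pulse_control A h \<phi>' t0) t0 t1 \<xi> X"
proof -
  let ?B = "cball 0 (5 * \<rho>) :: (real ^ 3) set"
  define P where "P = closest_point ?B"
  have B: "closed ?B" "convex ?B" "?B \<noteq> {}" using \<rho> by auto
  have P_in: "P z \<in> ?B" for z unfolding P_def by (rule closest_point_in_set[OF B(1,3)])
  have P_lip: "norm (P z - P w) \<le> norm (z - w)" for z w
    using closest_point_lipschitz[OF B(2,1,3), of z w] by (simp add: P_def dist_norm)
  have trunc: "\<bar>g (P z)\<bar> \<le> Q" "\<bar>g (P z) - g (P w)\<bar> \<le> Q * norm (z - w)"
    if "bounded_lipschitz_on ?B Q g" for g z w
  proof -
    show "\<bar>g (P z)\<bar> \<le> Q" using that P_in by (simp add: bounded_lipschitz_on_def)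
    have "\<bar>g (P z) - g (P w)\<bar> \<le> Q * norm (P z - P w)"
      using that P_in by (simp add: bounded_lipschitz_on_def)
    also have "\<dots> \<le> Q * norm (z - w)" using P_lip Q by (intro mult_left_mono) auto
    finally show "\<bar>g (P z) - g (P w)\<bar> \<le> Q * norm (z - w)" .
  qed
  define aP bP where "aP z = a (P z)" and "bP z = b (P z)" for z
  have bl: "bounded_lipschitz_on ?B Q aP" "bounded_lipschitz_on ?B Q bP"
    using trunc[OF a] trunc[OF b] by (simp_all add: bounded_lipschitz_on_def aP_def bP_def)
  have trunc_cont: "continuous_on S (\<lambda>s. g (P (X s)))"
    if g: "bounded_lipschitz_on ?B Q g" and X: "continuous_on S X" for g S and X :: "real \<Rightarrow> real ^ 3"
  proof -
    have "Q-lipschitz_on UNIV (\<lambda>z. g (P z))"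
      using trunc(2)[OF g] Q by (intro lipschitz_onI) (auto simp: dist_norm)
    then have "continuous_on UNIV (\<lambda>z. g (P z))" by (rule lipschitz_on_continuous_on)
    then show ?thesis using X by (rule continuous_on_compose2) simp
  qed
  \<comment> \<open>The known profile replaces the third state, so the right-hand side is Lipschitz with a small constant on the window.\<close>
  define G where "G s x = (vector [a (P x) * y s ^ L, b (P x) * y s, u s] :: real ^ 3)" for s x
  have G_cont: "continuous_on S (\<lambda>s. G s (X s))" if "continuous_on S X" for S X
    unfolding G_def
    by (intro continuous_on_vector3 continuous_on_mult continuous_on_power
        trunc_cont a b that continuous_y continuous_u)
  have \<rho>L: "\<rho> ^ 1 \<le> \<rho> ^ L" using \<rho> L by (intro power_increasing) auto
  obtain X where X: "\<And>t. t \<in> {t0..t0 + h} \<Longrightarrow> X t = \<xi> + integral {t0..t} (\<lambda>s. G s (X s))"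
    and X_cont: "continuous_on UNIV X" and X_const: "\<And>t. t \<ge> t0 + h \<Longrightarrow> X t = X (t0 + h)"
  proof (rule picard_fixed_point[where a = t0 and b = "t0 + h" and K = "2 * Q * \<rho> ^ L" and G = G and \<xi> = \<xi>])
    show "t0 \<le> t0 + h" "0 \<le> 2 * Q * \<rho> ^ L" "2 * Q * \<rho> ^ L * (t0 + h - t0) < 1"
      using h Q \<rho> by (simp_all add: mult_ac)
    fix s and x z :: "real ^ 3" assume s: "s \<in> {t0..t0 + h}"
    have ys: "\<bar>y s\<bar> \<le> \<rho>" using y_bound[of s] A s by simp
    have term_bound: "\<bar>g (P x) * y s ^ n - g (P z) * y s ^ n\<bar> \<le> Q * \<rho> ^ L * norm (x - z)"
      if g: "bounded_lipschitz_on ?B Q g" and n: "n \<le> L" for g n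
    proof -
      have "\<bar>y s\<bar> ^ n \<le> \<rho> ^ n" using ys by (intro power_mono) auto
      also have "\<dots> \<le> \<rho> ^ L" using \<rho> n by (intro power_increasing) auto
      finally have "\<bar>g (P x) - g (P z)\<bar> * \<bar>y s\<bar> ^ n \<le> (Q * norm (x - z)) * \<rho> ^ L"
        using trunc(2)[OF g] Q by (intro mult_mono) auto
      then show ?thesis by (simp add: abs_mult power_abs mult_ac flip: left_diff_distrib)
    qed
    have "norm (G s x - G s z) \<le> \<bar>a (P x) * y s ^ L - a (P z) * y s ^ L\<bar> + \<bar>b (P x) * y s ^ 1 - b (P z) * y s ^ 1\<bar>"
      using norm_vec3_le[of "G s x - G s z"] by (simp add: G_def)
    also have "\<dots> \<le> Q * \<rho> ^ L * norm (x - z) + Q * \<rho> ^ L * norm (x - z)"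
      by (intro add_mono term_bound a b order_refl L)
    finally show "norm (G s x - G s z) \<le> 2 * Q * \<rho> ^ L * norm (x - z)" by simp
  qed (use G_cont in auto)
  have X3: "X t $ 3 = y t" if "t \<ge> t0" for t
  proof (cases "t \<le> t0 + h")
    case True
    have "X t $ 3 = \<xi> $ 3 + integral {t0..t} (\<lambda>s. G s (X s) $ 3)"
      using X[of t] that True G_cont[OF continuous_on_subset[OF X_cont]]
      by (simp add: integrable_continuous_interval)
    then show ?thesis using integral_unique[OF integral_u[OF that]] by (simp add: G_def)
  next
    case False
    have "X (t0 + h) $ 3 = \<xi> $ 3 + integral {t0..t0 + h} (\<lambda>s. G s (X s) $ 3)"
      using X[of "t0 + h"] h(1) G_cont[OF continuous_on_subset[OF X_cont]]
      by (simp add: integrable_continuous_interval)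
    then have "X (t0 + h) $ 3 = y (t0 + h)"
      using integral_unique[OF integral_u[of "t0 + h"]] h(1) by (simp add: G_def)
    then show ?thesis using False X_const[of t] y_after by simp
  qed
  let ?f = "\<lambda>s. cascade aP bP L (X s) (pulse_control A h \<phi>' t0 s)"
  have f_eq: "?f s = G s (X s)" if "s \<ge> t0" for s
    using X3[OF that] by (simp add: cascade_def G_def pulse_control_def u_def aP_def bP_def)
  have f_cont: "continuous_on {t0..t} ?f" for t
    by (rule continuous_on_eq[OF G_cont[OF continuous_on_subset[OF X_cont]]]) (simp_all add: f_eq)
  have f_after: "?f s = 0" if "s \<ge> t0 + h" for s
  proof -
    have "?f s = G s (X s)" using that h(1) by (intro f_eq) simp
    also have "\<dots> = 0"
      using L y_after[OF that] u_after[OF that] by (simp add: G_def vec_eq_iff forall_3)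
    finally show ?thesis .
  qed
  have sol: "segment_solution (cascade aP bP L) (pulse_control A h \<phi>' t0) t0 t1 \<xi> X"
    unfolding segment_solution_def
  proof (intro ballI conjI)
    fix t assume t: "t \<in> {t0..t1}"
    show "?f absolutely_integrable_on {t0..t}" by (rule absolutely_integrable_continuous_real[OF f_cont])
    have eq: "X r = \<xi> + integral {t0..r} ?f" if "r \<in> {t0..t0 + h}" for r
      using X[OF that] Henstock_Kurzweil_Integration.integral_cong[of "{t0..r}" ?f "\<lambda>s. G s (X s)"] f_eq
      by simp
    show "X t = \<xi> + integral {t0..t} ?f"
    proof (cases "t \<le> t0 + h")
      case False
      have "integral {t0..t} ?f = integral {t0..t0 + h} ?f + integral {t0 + h..t} ?f"
        using False h(1) f_cont
        by (intro Henstock_Kurzweil_Integration.integral_combine[symmetric] integrable_continuous_interval) auto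
      also have "integral {t0 + h..t} ?f = integral {t0 + h..t} (\<lambda>s. 0)"
        by (intro Henstock_Kurzweil_Integration.integral_cong) (simp add: f_after)
      finally show ?thesis using False X_const[of t] eq[of "t0 + h"] h(1) by simp
    qed (use t eq in auto)
  qed
  interpret trunc: pulse aP bP
    by unfold_locales (use L Q \<rho> bl shape A start \<xi> h t1 in auto)
  have "P (X s) = X s" if "s \<in> {t0..t1}" for s
    unfolding P_def using trunc.displacement(1)[OF sol that] by (rule closest_point_self)
  then have "segment_solution (cascade a b L) (pulse_control A h \<phi>' t0) t0 t1 \<xi> X"
    using sol segment_solution_cong[of t0 t1 X X "cascade a b L" "pulse_control A h \<phi>' t0"
        "cascade aP bP L" "pulse_control A h \<phi>' t0" \<xi>]
    by (simp add: cascade_def aP_def bP_def)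
  then show ?thesis by blast
qed

end

section \<open>The steering law and its Lyapunov function\<close>

definition lyap :: "nat \<Rightarrow> real ^ 3 \<Rightarrow> real" where
  "lyap L \<xi> = \<bar>\<xi> $ 1\<bar> + \<bar>\<xi> $ 2\<bar> ^ L"

definition small_second :: "nat \<Rightarrow> real \<Rightarrow> real ^ 3 \<Rightarrow> bool" where
  "small_second L \<mu> \<xi> \<longleftrightarrow> \<bar>\<xi> $ 2\<bar> \<le> \<mu>\<^sup>2 * root L \<bar>\<xi> $ 1\<bar>"

text \<open>A state that is not at rest is ramped down. Otherwise the sign of the amplitude is chosen so that
the first-order effect of the pulse opposes the sign of the state which it reduces; the powers of
\<open>root L\<close> make \<open>amplitude ^ L\<close> proportional to the first state.\<close>

definition amplitude :: "(real ^ 3 \<Rightarrow> real) \<Rightarrow> (real ^ 3 \<Rightarrow> real) \<Rightarrow> nat \<Rightarrow> real \<Rightarrow> real ^ 3 \<Rightarrow> real" where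
  "amplitude a b L \<mu> \<xi> =
     (if \<xi> $ 3 \<noteq> 0 then \<xi> $ 3
      else if small_second L \<mu> \<xi> then - (sgn (\<xi> $ 1) * sgn (a \<xi>) * (\<mu> * root L \<bar>\<xi> $ 1\<bar>))
      else - (sgn (\<xi> $ 2) * sgn (b \<xi>) * (\<mu> * \<bar>\<xi> $ 2\<bar>)))"

definition profile :: "nat \<Rightarrow> real \<Rightarrow> real ^ 3 \<Rightarrow> real \<Rightarrow> real" where
  "profile L \<mu> \<xi> =
     (if \<xi> $ 3 \<noteq> 0 then ramp else if small_second L \<mu> \<xi> then skew_pulse else bump)"

definition profile_deriv :: "nat \<Rightarrow> real \<Rightarrow> real ^ 3 \<Rightarrow> real \<Rightarrow> real" where
  "profile_deriv L \<mu> \<xi> =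
     (if \<xi> $ 3 \<noteq> 0 then ramp_deriv else if small_second L \<mu> \<xi> then skew_pulse_deriv else bump_deriv)"

text \<open>Up to a constant, this bounds the sampled state, the amplitude, and hence the state until
the next sample.\<close>

definition state_size :: "nat \<Rightarrow> real ^ 3 \<Rightarrow> real" where
  "state_size L \<xi> = \<bar>\<xi> $ 1\<bar> + \<bar>\<xi> $ 2\<bar> + \<bar>\<xi> $ 3\<bar> + root L \<bar>\<xi> $ 1\<bar>"

lemma control_shape_profile: "control_shape (profile L \<mu> \<xi>) (profile_deriv L \<mu> \<xi>)"
  by (simp add: profile_def profile_deriv_def control_shape_ramp control_shape_skew_pulse
      control_shape_bump)

lemma profile_start: "amplitude a b L \<mu> \<xi> * profile L \<mu> \<xi> 0 = \<xi> $ 3"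
  by (simp add: amplitude_def profile_def ramp_def skew_pulse_def bump_eq_0)

lemma power_diff_le:
  fixes z w :: real
  assumes "0 \<le> z" "z \<le> w"
  shows "w ^ n - z ^ n \<le> real n * (w - z) * w ^ (n - 1)"
proof (induction n)
  case (Suc n)
  have "w ^ Suc n - z ^ Suc n = w * (w ^ n - z ^ n) + (w - z) * z ^ n" by (simp add: algebra_simps)
  also have "\<dots> \<le> w * (real n * (w - z) * w ^ (n - 1)) + (w - z) * w ^ n"
    using Suc assms by (intro add_mono mult_left_mono power_mono) auto
  also have "w * (real n * (w - z) * w ^ (n - 1)) = real n * (w - z) * w ^ n"
    by (cases n) simp_all
  finally show ?case by (simp add: algebra_simps)
qed simp

text \<open>The constant \<open>m\<close> bounds the gains \<open>\<bar>a\<bar>\<close> and \<open>\<bar>b\<bar>\<close> from below, \<open>\<gamma>\<close> the moments of the two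
pulses. The last condition on \<open>\<mu>\<close> makes every error term at most half of the main term; its
factor \<open>2 ^ (L + 2) * real L\<close> comes from the growth of \<open>\<bar>x\<^sub>2\<bar> ^ L\<close> under a skew pulse.\<close>

locale steering =
  fixes a b :: "real ^ 3 \<Rightarrow> real" and L :: nat and Q \<rho> m \<mu> \<gamma> :: real
  assumes L: "L \<ge> 3" "odd L" and Q: "Q \<ge> 1" and \<rho>: "\<rho> \<ge> 1"
    and a: "bounded_lipschitz_on (cball 0 (5 * \<rho>)) Q a"
    and b: "bounded_lipschitz_on (cball 0 (5 * \<rho>)) Q b"
    and m: "m > 0" and a_low: "\<And>z. norm z \<le> \<rho> \<Longrightarrow> m \<le> \<bar>a z\<bar>" and b_low: "\<And>z. norm z \<le> \<rho> \<Longrightarrow> m \<le> \<bar>b z\<bar>"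
    and \<gamma>: "\<gamma> > 0" "\<gamma> \<le> integral {0..1} (\<lambda>s. skew_pulse s ^ L)" "\<gamma> \<le> integral {0..1} bump"
    and \<mu>: "\<mu> > 0" "\<mu> \<le> 1" "2 ^ (L + 2) * real L * Q * \<rho> * \<mu> \<le> m * \<gamma>"
begin

lemma root_bounds:
  assumes "norm \<xi> \<le> \<rho>"
  shows "0 \<le> root L \<bar>\<xi> $ 1\<bar>" "root L \<bar>\<xi> $ 1\<bar> \<le> \<rho>" "root L \<bar>\<xi> $ 1\<bar> ^ L = \<bar>\<xi> $ 1\<bar>"
proof -
  have "L > 0" using L by simp
  show "0 \<le> root L \<bar>\<xi> $ 1\<bar>" using \<open>L > 0\<close> by (simp add: real_root_ge_zero)
  show "root L \<bar>\<xi> $ 1\<bar> ^ L = \<bar>\<xi> $ 1\<bar>" using \<open>L > 0\<close> by simp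
  have "\<bar>\<xi> $ 1\<bar> \<le> \<rho> ^ 1" using component_le_norm_cart[of \<xi> 1] assms by simp
  also have "\<dots> \<le> \<rho> ^ L" using \<rho> L by (intro power_increasing) auto
  finally have "root L \<bar>\<xi> $ 1\<bar> \<le> root L (\<rho> ^ L)" using \<open>L > 0\<close> by simp
  then show "root L \<bar>\<xi> $ 1\<bar> \<le> \<rho>" using \<open>L > 0\<close> \<rho> by (simp add: real_root_power_cancel)
qed

lemma abs_sgn_mult_le: "0 \<le> c \<Longrightarrow> \<bar>- (sgn p * sgn q * c)\<bar> \<le> (c :: real)"
  by (auto simp: sgn_if abs_mult)

lemma amplitude_bound:
  "\<bar>amplitude a b L \<mu> \<xi>\<bar> \<le>
    (if \<xi> $ 3 \<noteq> 0 then \<bar>\<xi> $ 3\<bar> else if small_second L \<mu> \<xi> then \<mu> * root L \<bar>\<xi> $ 1\<bar> else \<mu> * \<bar>\<xi> $ 2\<bar>)"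
proof -
  have "0 \<le> \<mu> * root L \<bar>\<xi> $ 1\<bar>" "0 \<le> \<mu> * \<bar>\<xi> $ 2\<bar>"
    using L \<mu>(1) by (simp_all add: real_root_ge_zero)
  from this[THEN abs_sgn_mult_le] show ?thesis
    unfolding amplitude_def
    by (cases "\<xi> $ 3 = 0"; cases "small_second L \<mu> \<xi>")
      (simp_all only: if_True if_False simp_thms order_refl)
qed

lemma amplitude_le_state_size:
  "\<bar>amplitude a b L \<mu> \<xi>\<bar> \<le> \<bar>\<xi> $ 2\<bar> + \<bar>\<xi> $ 3\<bar> + root L \<bar>\<xi> $ 1\<bar>"
proof -
  have r: "0 \<le> root L \<bar>\<xi> $ 1\<bar>" using L by (simp add: real_root_ge_zero)
  have "x \<le> y2 + y3 + r"
    if "x \<le> (if p then y3 else if q then \<mu> * r else \<mu> * y2)" "0 \<le> r" "0 \<le> y2" "0 \<le> y3"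
    for x y2 y3 r :: real and p q
    using that mult_left_le_one_le[of r \<mu>] mult_left_le_one_le[of y2 \<mu>] \<mu> by (auto split: if_splits)
  from this[OF amplitude_bound r] show ?thesis by simp
qed

lemma amplitude_le_radius:
  assumes "norm \<xi> \<le> \<rho>" shows "\<bar>amplitude a b L \<mu> \<xi>\<bar> \<le> \<rho>"
proof -
  have c: "\<bar>\<xi> $ i\<bar> \<le> \<rho>" for i using component_le_norm_cart[of \<xi> i] assms by simp
  have "\<mu> * c \<le> \<rho>" if "0 \<le> c" "c \<le> \<rho>" for c
    using \<mu> that mult_left_le_one_le[of c \<mu>] by simp
  from this[of "root L \<bar>\<xi> $ 1\<bar>"] this[of "\<bar>\<xi> $ 2\<bar>"] show ?thesis
    using root_bounds[OF assms] c[of 2] c[of 3] amplitude_bound[of \<xi>] by (simp split: if_splits)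
qed

lemma pulse_instance:
  assumes "norm \<xi> \<le> \<rho>" "h > 0" "8 * Q * \<rho> ^ L * h \<le> 1" "t0 + h \<le> t1"
  shows "pulse a b L Q \<rho> (profile L \<mu> \<xi>) (profile_deriv L \<mu> \<xi>) (amplitude a b L \<mu> \<xi>) h t0 t1 \<xi>"
  using assms L Q \<rho> a b control_shape_profile amplitude_le_radius profile_start
  by unfold_locales auto

lemma small_gain: "4 * Q * \<rho> * \<mu> \<le> m * \<gamma>" "4 * Q * \<mu> \<le> m * \<gamma>"
proof -
  have "(4::real) * 1 \<le> 2 ^ (L + 2) * real L" using L
    by (intro mult_mono) (auto simp: power_add)
  then have "4 * (Q * \<rho> * \<mu>) \<le> (2 ^ (L + 2) * real L) * (Q * \<rho> * \<mu>)"
    using Q \<rho> \<mu> by (intro mult_right_mono) auto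
  also have "\<dots> \<le> m * \<gamma>" using \<mu>(3) by (simp add: mult_ac)
  finally show 1: "4 * Q * \<rho> * \<mu> \<le> m * \<gamma>" by (simp add: mult_ac)
  have "4 * Q * \<mu> * 1 \<le> 4 * Q * \<mu> * \<rho>" using Q \<mu> \<rho> by (intro mult_left_mono) auto
  then show "4 * Q * \<mu> \<le> m * \<gamma>" using 1 by (simp add: mult_ac)
qed

text \<open>The exact first-order step multiplies \<open>x\<close> by \<open>1 - \<alpha> * \<kappa> * c * h\<close>; an error of half the
guaranteed decrease leaves the other half.\<close>

lemma coordinate_contraction:
  assumes \<alpha>: "m \<le> \<alpha>" "\<alpha> \<le> Q" and \<kappa>: "\<gamma> \<le> \<kappa>" "\<kappa> \<le> 1" and c: "0 \<le> c" "c \<le> 1"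
    and h: "0 < h" "Q * h \<le> 1"
    and n: "\<bar>n - x + sgn x * (\<alpha> * \<kappa> * c * \<bar>x\<bar> * h)\<bar> \<le> m * \<gamma> / 2 * (c * \<bar>x\<bar> * h)"
  shows "\<bar>n\<bar> \<le> \<bar>x\<bar> * (1 - m * \<gamma> / 2 * (c * h))" and "m * \<gamma> / 2 * (c * h) \<le> 1"
proof -
  have \<alpha>\<kappa>: "m * \<gamma> \<le> \<alpha> * \<kappa>" using \<alpha> \<kappa> m \<gamma> by (intro mult_mono) auto
  have "\<alpha> * \<kappa> \<le> Q * 1" using \<alpha> \<kappa> m \<gamma> Q by (intro mult_mono) auto
  then have "\<alpha> * \<kappa> * (c * h) \<le> Q * (1 * h)"
    using c h \<alpha> \<kappa> m \<gamma> Q by (intro mult_mono) auto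
  then have le1: "\<alpha> * \<kappa> * (c * h) \<le> 1" using h(2) unfolding mult_1 by (rule order_trans)
  have lower: "m * \<gamma> * (c * h) \<le> \<alpha> * \<kappa> * (c * h)" using \<alpha>\<kappa> c h by (intro mult_right_mono) auto
  moreover have "0 \<le> m * \<gamma> * (c * h)" using m \<gamma> c h by simp
  ultimately show "m * \<gamma> / 2 * (c * h) \<le> 1" using le1 by simp
  have "x - sgn x * (\<alpha> * \<kappa> * c * \<bar>x\<bar> * h) = x * (1 - \<alpha> * \<kappa> * (c * h))"
    by (simp add: sgn_if abs_if algebra_simps)
  then have "\<bar>x - sgn x * (\<alpha> * \<kappa> * c * \<bar>x\<bar> * h)\<bar> = \<bar>x\<bar> * (1 - \<alpha> * \<kappa> * (c * h))"
    using le1 by (simp add: abs_mult)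
  also have "\<dots> \<le> \<bar>x\<bar> * (1 - m * \<gamma> * (c * h))" using lower by (intro mult_left_mono) auto
  finally have "\<bar>x - sgn x * (\<alpha> * \<kappa> * c * \<bar>x\<bar> * h)\<bar> \<le> \<bar>x\<bar> * (1 - m * \<gamma> * (c * h))" .
  then have "\<bar>n\<bar> \<le> \<bar>x\<bar> * (1 - m * \<gamma> * (c * h)) + m * \<gamma> / 2 * (c * \<bar>x\<bar> * h)"
    using n by linarith
  then show "\<bar>n\<bar> \<le> \<bar>x\<bar> * (1 - m * \<gamma> / 2 * (c * h))" by (simp add: algebra_simps)
qed

text \<open>The smaller of the two guaranteed fractions; the factor \<open>\<mu> ^ (2 * L)\<close> stems from the states just
above the threshold.\<close>

definition rate :: real where "rate = m * \<gamma> * \<mu> ^ (2 * L + 1) / 8"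

lemma rate_pos: "rate > 0" using m \<gamma> \<mu> by (simp add: rate_def)

text \<open>A skew pulse of amplitude \<open>\<mu> * r\<close> shrinks \<open>x1\<close> by a fraction of order \<open>\<mu> ^ L * h\<close>. It shifts
\<open>x2\<close> by \<open>d\<close> of order \<open>\<mu>\<^sup>2 * r\<^sup>2 * h\<close>. As \<open>\<bar>x2\<bar>\<close> and \<open>d\<close> are at most \<open>\<mu>\<^sup>2 * r\<close>, the
power \<open>\<bar>x2\<bar> ^ L\<close> grows by the order of \<open>\<mu> ^ (2 * L) * \<bar>x1\<bar> * h\<close> only, which is smaller than the
decrease of \<open>\<bar>x1\<bar>\<close> by a factor \<open>\<mu> ^ L\<close>. The threshold \<open>\<mu>\<^sup>2\<close> is chosen for this
comparison.\<close>

lemma small_second_decrease: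
  assumes r: "0 \<le> r" "r \<le> \<rho>" "r ^ L = \<bar>x1\<bar>" and x2: "\<bar>x2\<bar> \<le> \<mu>\<^sup>2 * r"
    and h: "0 < h" "8 * Q * \<rho> * h \<le> 1" and \<alpha>: "m \<le> \<alpha>" "\<alpha> \<le> Q" and \<kappa>: "\<gamma> \<le> \<kappa>" "\<kappa> \<le> 1"
    and n1: "\<bar>n1 - x1 + sgn x1 * (\<alpha> * \<kappa> * \<mu> ^ L * \<bar>x1\<bar> * h)\<bar> \<le> 2 * Q * (\<mu> * r) ^ Suc L * h"
    and n2: "\<bar>n2 - x2\<bar> \<le> 2 * Q * (\<mu> * r)\<^sup>2 * h"
  shows "\<bar>n1\<bar> + \<bar>n2\<bar> ^ L \<le> (\<bar>x1\<bar> + \<bar>x2\<bar> ^ L) - rate * h * (\<bar>x1\<bar> + \<bar>x2\<bar> ^ L)"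
proof -
  have Qh: "Q * h \<le> 1"
  proof -
    have "Q * h * 1 \<le> Q * h * (8 * \<rho>)" using Q h \<rho> by (intro mult_left_mono) auto
    then show ?thesis using h(2) by (simp add: mult_ac)
  qed
  have \<mu>L: "0 < \<mu> ^ L" "\<mu> ^ L \<le> 1" "\<mu> ^ L \<le> \<mu>"
    using \<mu> L power_decreasing[of 1 L \<mu>] by (auto simp: power_le_one)
  define w where "w = \<mu> ^ L * \<bar>x1\<bar> * h"
  have w: "0 \<le> w" using \<mu>L h by (simp add: w_def)
  have "2 * Q * (\<mu> * r) ^ Suc L * h = 2 * Q * \<mu> * r * w"
    by (simp add: w_def power_mult_distrib r(3)[symmetric] mult_ac)
  also have "\<dots> \<le> 2 * Q * \<mu> * \<rho> * w" using r Q \<mu> w by (intro mult_right_mono mult_left_mono) auto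
  also have "\<dots> \<le> m * \<gamma> / 2 * w" using small_gain(1) w by (intro mult_right_mono) (auto simp: mult_ac)
  finally have "\<bar>n1\<bar> \<le> \<bar>x1\<bar> * (1 - m * \<gamma> / 2 * (\<mu> ^ L * h))"
    using coordinate_contraction(1)[OF \<alpha> \<kappa> _ \<mu>L(2) h(1) Qh, of n1 x1] \<mu>L n1 by (simp add: w_def)
  then have n1': "\<bar>n1\<bar> \<le> \<bar>x1\<bar> - m * \<gamma> / 2 * w" by (simp add: w_def algebra_simps)
  define d where "d = 2 * Q * (\<mu> * r)\<^sup>2 * h"
  have d0: "0 \<le> d" using Q h by (simp add: d_def)
  have d_eq: "d = (2 * Q * r * h) * (\<mu>\<^sup>2 * r)" by (simp add: d_def power2_eq_square mult_ac)
  have "2 * Q * h * r \<le> 2 * Q * h * \<rho>" using r Q h by (intro mult_left_mono) auto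
  also have "\<dots> \<le> 1" using h Q \<rho> by (simp add: mult_ac)
  finally have rh: "2 * Q * r * h \<le> 1" by (simp add: mult_ac)
  have d1: "d \<le> \<mu>\<^sup>2 * r" unfolding d_eq using rh r by (intro mult_left_le_one_le) (use Q h in auto)
  have "\<bar>n2\<bar> ^ L \<le> (\<bar>x2\<bar> + d) ^ L" using n2 by (intro power_mono) (auto simp: d_def)
  moreover have "(\<bar>x2\<bar> + d) ^ L - \<bar>x2\<bar> ^ L \<le> real L * d * (\<bar>x2\<bar> + d) ^ (L - 1)"
    using power_diff_le[of "\<bar>x2\<bar>" "\<bar>x2\<bar> + d" L] d0 by simp
  moreover have "real L * d * (\<bar>x2\<bar> + d) ^ (L - 1) \<le> real L * d * (2 * (\<mu>\<^sup>2 * r)) ^ (L - 1)"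
    using d0 d1 x2 by (intro mult_left_mono power_mono) auto
  moreover have "real L * d * (2 * (\<mu>\<^sup>2 * r)) ^ (L - 1) = real L * Q * r * 2 ^ L * \<mu> ^ L * w"
  proof -
    obtain l where l: "L = Suc l" using L by (cases L) auto
    have "r * (r ^ l * r) = r * \<bar>x1\<bar>" using r(3) l by (simp add: mult_ac)
    then show ?thesis
      unfolding d_eq w_def r(3)[symmetric] l
      by (simp add: power_mult_distrib power2_eq_square mult_ac)
  qed
  moreover have "real L * Q * r * 2 ^ L * \<mu> ^ L * w \<le> m * \<gamma> / 4 * w"
  proof (rule mult_right_mono[OF _ w])
    have "real L * Q * r * 2 ^ L * \<mu> ^ L \<le> real L * Q * \<rho> * 2 ^ L * \<mu>"
      using r Q \<rho> \<mu>L by (intro mult_mono) auto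
    also have "\<dots> \<le> m * \<gamma> / 4" using \<mu>(3) by (simp add: power_add mult_ac)
    finally show "real L * Q * r * 2 ^ L * \<mu> ^ L \<le> m * \<gamma> / 4" .
  qed
  ultimately have n2': "\<bar>n2\<bar> ^ L \<le> \<bar>x2\<bar> ^ L + m * \<gamma> / 4 * w" by linarith
  have "\<bar>x2\<bar> ^ L \<le> (1 * r) ^ L"
    using x2 r \<mu> order_trans[OF x2 mult_right_mono[of "\<mu>\<^sup>2" 1 r]] by (intro power_mono) (auto simp: power_le_one)
  then have V: "\<bar>x1\<bar> + \<bar>x2\<bar> ^ L \<le> 2 * \<bar>x1\<bar>" using r(3) by simp
  have "\<mu> ^ (2 * L + 1) \<le> \<mu> ^ L" using \<mu> by (intro power_decreasing) auto
  then have "rate \<le> m * \<gamma> / 8 * \<mu> ^ L" using m \<gamma> by (simp add: rate_def)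
  then have "rate * (h * (\<bar>x1\<bar> + \<bar>x2\<bar> ^ L)) \<le> (m * \<gamma> / 8 * \<mu> ^ L) * (h * (2 * \<bar>x1\<bar>))"
    using V h m \<gamma> \<mu>L by (intro mult_mono) auto
  also have "\<dots> = m * \<gamma> / 4 * w" by (simp add: w_def mult_ac)
  finally show ?thesis using n1' n2' by (simp add: mult_ac)
qed

text \<open>A bump of amplitude \<open>\<mu> * \<bar>x2\<bar>\<close> shrinks \<open>\<bar>x2\<bar> ^ L\<close> by a fraction of order \<open>\<mu> * h\<close>, while
\<open>\<bar>x1\<bar>\<close> grows by at most \<open>Q * \<mu> ^ L * \<bar>x2\<bar> ^ L * h\<close>, which is of higher order in \<open>\<mu>\<close>. The
threshold bounds \<open>\<mu> ^ (2 * L) * \<bar>x1\<bar>\<close> by \<open>\<bar>x2\<bar> ^ L\<close>, so the decrease is a fixed fraction of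
the whole Lyapunov function.\<close>

lemma large_second_decrease:
  assumes r: "0 \<le> r" "r ^ L = \<bar>x1\<bar>" and x2: "\<mu>\<^sup>2 * r \<le> \<bar>x2\<bar>" "\<bar>x2\<bar> \<le> \<rho>"
    and h: "0 < h" "Q * h \<le> 1" and \<alpha>: "m \<le> \<alpha>" "\<alpha> \<le> Q" and \<kappa>: "\<gamma> \<le> \<kappa>" "\<kappa> \<le> 1"
    and n1: "\<bar>n1 - x1\<bar> \<le> Q * (\<mu> * \<bar>x2\<bar>) ^ L * h"
    and n2: "\<bar>n2 - x2 + sgn x2 * (\<alpha> * \<kappa> * \<mu> * \<bar>x2\<bar> * h)\<bar> \<le> 2 * Q * (\<mu> * \<bar>x2\<bar>)\<^sup>2 * h"
  shows "\<bar>n1\<bar> + \<bar>n2\<bar> ^ L \<le> (\<bar>x1\<bar> + \<bar>x2\<bar> ^ L) - rate * h * (\<bar>x1\<bar> + \<bar>x2\<bar> ^ L)"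
proof -
  define w where "w = \<mu> * \<bar>x2\<bar> * h"
  have w: "0 \<le> w" using \<mu> h by (simp add: w_def)
  define \<theta> where "\<theta> = m * \<gamma> / 2 * (\<mu> * h)"
  have \<theta>0: "0 \<le> \<theta>" using m \<gamma> \<mu> h by (simp add: \<theta>_def)
  have "2 * Q * (\<mu> * \<bar>x2\<bar>)\<^sup>2 * h = 2 * Q * \<mu> * \<bar>x2\<bar> * w" by (simp add: w_def power2_eq_square mult_ac)
  also have "\<dots> \<le> 2 * Q * \<mu> * \<rho> * w" using x2 Q \<mu> w by (intro mult_right_mono mult_left_mono) auto
  also have "\<dots> \<le> m * \<gamma> / 2 * w" using small_gain(1) w by (intro mult_right_mono) (auto simp: mult_ac)
  finally have err: "\<bar>n2 - x2 + sgn x2 * (\<alpha> * \<kappa> * \<mu> * \<bar>x2\<bar> * h)\<bar> \<le> m * \<gamma> / 2 * (\<mu> * \<bar>x2\<bar> * h)"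
    using n2 by (simp add: w_def)
  note contr = coordinate_contraction[OF \<alpha> \<kappa> _ \<mu>(2) h err, folded \<theta>_def]
  have \<theta>1: "\<theta> \<le> 1" and n2': "\<bar>n2\<bar> \<le> \<bar>x2\<bar> * (1 - \<theta>)" using contr \<mu>(1) by simp_all
  have "\<bar>n2\<bar> ^ L \<le> (\<bar>x2\<bar> * (1 - \<theta>)) ^ L" using n2' by (intro power_mono) auto
  also have "\<dots> = \<bar>x2\<bar> ^ L * (1 - \<theta>) ^ L" by (simp add: power_mult_distrib)
  also have "\<dots> \<le> \<bar>x2\<bar> ^ L * (1 - \<theta>) ^ 1"
    using \<theta>0 \<theta>1 L by (intro mult_left_mono power_decreasing) auto
  finally have n2'': "\<bar>n2\<bar> ^ L \<le> \<bar>x2\<bar> ^ L - \<theta> * \<bar>x2\<bar> ^ L" by (simp add: algebra_simps)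
  have "\<mu> ^ L \<le> \<mu> ^ 2" using \<mu> L by (intro power_decreasing) auto
  then have "Q * \<mu> ^ L * (\<bar>x2\<bar> ^ L * h) \<le> Q * \<mu> ^ 2 * (\<bar>x2\<bar> ^ L * h)"
    using Q h by (intro mult_right_mono mult_left_mono) auto
  also have "\<dots> = (Q * \<mu>) * (\<mu> * (\<bar>x2\<bar> ^ L * h))" by (simp add: power2_eq_square mult_ac)
  also have "\<dots> \<le> (m * \<gamma> / 4) * (\<mu> * (\<bar>x2\<bar> ^ L * h))"
    using small_gain(2) \<mu>(1) h(1) by (intro mult_right_mono) auto
  also have "\<dots> = \<theta> / 2 * \<bar>x2\<bar> ^ L" by (simp add: \<theta>_def)
  finally have n1': "\<bar>n1\<bar> \<le> \<bar>x1\<bar> + \<theta> / 2 * \<bar>x2\<bar> ^ L"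
    using n1 by (simp add: power_mult_distrib mult_ac)
  have "(\<mu>\<^sup>2 * r) ^ L \<le> \<bar>x2\<bar> ^ L" using x2(1) r \<mu> by (intro power_mono) auto
  then have "\<mu> ^ (2 * L) * \<bar>x1\<bar> \<le> \<bar>x2\<bar> ^ L" using r by (simp add: power_mult_distrib power_mult)
  moreover have "\<mu> ^ (2 * L) * \<bar>x2\<bar> ^ L \<le> 1 * \<bar>x2\<bar> ^ L"
    using \<mu> by (intro mult_right_mono power_le_one) auto
  ultimately have "\<mu> ^ (2 * L) * (\<bar>x1\<bar> + \<bar>x2\<bar> ^ L) \<le> 2 * \<bar>x2\<bar> ^ L" by (simp add: algebra_simps)
  then have "m * \<gamma> / 8 * (\<mu> * h) * (\<mu> ^ (2 * L) * (\<bar>x1\<bar> + \<bar>x2\<bar> ^ L)) \<le>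
      m * \<gamma> / 8 * (\<mu> * h) * (2 * \<bar>x2\<bar> ^ L)"
    using m \<gamma> \<mu> h by (intro mult_left_mono) auto
  then have "rate * h * (\<bar>x1\<bar> + \<bar>x2\<bar> ^ L) \<le> \<theta> / 2 * \<bar>x2\<bar> ^ L"
    by (simp add: rate_def \<theta>_def mult_ac)
  then show ?thesis using n1' n2'' by simp
qed

definition hmax :: real where "hmax = 1 / (8 * Q * \<rho> ^ L)"

lemma hmax_pos: "hmax > 0" using Q \<rho> by (simp add: hmax_def)

lemma window_admissible: "h \<le> hmax \<Longrightarrow> 8 * Q * \<rho> ^ L * h \<le> 1"
  using Q \<rho> by (simp add: hmax_def field_simps)

definition steers :: "real ^ 3 \<Rightarrow> real \<Rightarrow> real \<Rightarrow> real \<Rightarrow> (real \<Rightarrow> real ^ 3) \<Rightarrow> bool" where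
  "steers \<xi> h t0 t1 X \<longleftrightarrow> segment_solution (cascade a b L)
     (pulse_control (amplitude a b L \<mu> \<xi>) h (profile_deriv L \<mu> \<xi>) t0) t0 t1 \<xi> X"

lemma lyap_nonneg: "0 \<le> lyap L \<xi>" by (simp add: lyap_def)

context
  fixes \<xi> :: "real ^ 3" and h t0 t1 :: real
  assumes \<xi>: "norm \<xi> \<le> \<rho>" and h: "0 < h" "h \<le> hmax" and t1: "t0 + h \<le> t1"
begin

interpretation response: pulse a b L Q \<rho> "profile L \<mu> \<xi>" "profile_deriv L \<mu> \<xi>" "amplitude a b L \<mu> \<xi>" h t0 t1 \<xi>
  by (rule pulse_instance[OF \<xi> h(1) window_admissible[OF h(2)] t1])

lemma steers_exists: "\<exists>X. steers \<xi> h t0 t1 X"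
  unfolding steers_def by (rule response.response_exists)

lemma steers_end_at_rest: "steers \<xi> h t0 t1 X \<Longrightarrow> X t1 $ 3 = 0"
  unfolding steers_def by (rule response.end_at_rest)

lemma steers_intersample:
  assumes "steers \<xi> h t0 t1 X" and t: "t \<in> {t0..t1}"
  shows "norm (X t) \<le> 3 * state_size L \<xi>"
    and "\<bar>X t $ 1\<bar> \<le> \<bar>\<xi> $ 1\<bar> + 1" and "\<bar>X t $ 2\<bar> \<le> \<bar>\<xi> $ 2\<bar> + 1"
proof -
  note d = response.displacement[OF assms[unfolded steers_def]]
  have L1: "L \<ge> 1" using L by simp
  note p = response.power_A_bound[OF L1 order_refl] response.power_A_bound[OF order_refl L1]
  note g = response.gain_bound[OF L1 order_refl] response.gain_bound[OF order_refl L1]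
  have X: "norm (X t) \<le> \<bar>\<xi> $ 1\<bar> + \<bar>\<xi> $ 2\<bar> + 2 * \<bar>amplitude a b L \<mu> \<xi>\<bar>"
    using norm_vec3_le[of "X t"] d p unfolding power_one_right by linarith
  have r: "0 \<le> root L \<bar>\<xi> $ 1\<bar>" using L by (simp add: real_root_ge_zero)
  have lin: "n \<le> 3 * (p + q + s + r)"
    if "n \<le> p + q + 2 * A" "A \<le> q + s + r" "0 \<le> p" "0 \<le> q" "0 \<le> s" "0 \<le> r" for n p q s r A :: real
    using that by simp
  show "norm (X t) \<le> 3 * state_size L \<xi>"
    unfolding state_size_def by (rule lin[OF X amplitude_le_state_size _ _ _ r]) simp_all
  show "\<bar>X t $ 1\<bar> \<le> \<bar>\<xi> $ 1\<bar> + 1" "\<bar>X t $ 2\<bar> \<le> \<bar>\<xi> $ 2\<bar> + 1"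
    using d g unfolding power_one_right by linarith+
qed

text \<open>With the chosen signs, the leading terms of \<open>net_displacement\<close> are the contractions assumed in
\<open>small_second_decrease\<close> and \<open>large_second_decrease\<close>.\<close>

lemma steers_decrease:
  assumes sol: "steers \<xi> h t0 t1 X" and rest: "\<xi> $ 3 = 0"
  shows "lyap L (X t1) \<le> lyap L \<xi> - rate * h * lyap L \<xi>"
proof -
  let ?r = "root L \<bar>\<xi> $ 1\<bar>"
  let ?A = "amplitude a b L \<mu> \<xi>"
  note net = response.net_displacement[OF sol[unfolded steers_def] rest]
  have t1': "t1 \<in> {t0..t1}" using t1 h(1) by simp
  note disp = response.displacement[OF sol[unfolded steers_def] t1']
  note r = root_bounds[OF \<xi>]
  have \<xi>5: "\<xi> \<in> cball 0 (5 * \<rho>)" using \<xi> \<rho> by simp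
  have a_bd: "m \<le> \<bar>a \<xi>\<bar>" "\<bar>a \<xi>\<bar> \<le> Q" and b_bd: "m \<le> \<bar>b \<xi>\<bar>" "\<bar>b \<xi>\<bar> \<le> Q"
    using a_low b_low \<xi> \<xi>5 a b by (auto simp: bounded_lipschitz_on_def)
  have sgn_pow: "sgn x ^ L = sgn x" for x :: real
    using L power_minus_odd[OF L(2), of "1 :: real"] by (auto simp: sgn_if zero_power)
  have neg: "(- z) ^ L = - (z ^ L)" for z :: real using L(2) by simp
  have \<rho>L: "\<rho> \<le> \<rho> ^ L" using power_increasing[of 1 L \<rho>] \<rho> L by simp
  have hw: "8 * Q * \<rho> ^ L * h \<le> 1" by (rule window_admissible[OF h(2)])
  have "8 * Q * h * \<rho> \<le> 8 * Q * h * \<rho> ^ L" using \<rho>L Q h by (intro mult_left_mono) auto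
  then have h\<rho>: "8 * Q * \<rho> * h \<le> 1" using hw by (simp add: mult_ac)
  have "8 * Q * h * 1 \<le> 8 * Q * h * \<rho>" using \<rho> Q h by (intro mult_left_mono) auto
  moreover have "0 \<le> Q * h" using Q h by simp
  ultimately have Qh: "Q * h \<le> 1" using h\<rho> by (simp add: mult_ac)
  have abs_eq: "\<bar>x\<bar> = sgn x * x" for x :: real by (simp add: sgn_if)
  show ?thesis
  proof (cases "small_second L \<mu> \<xi>")
    case True
    have A_eq: "?A = - (sgn (\<xi> $ 1) * sgn (a \<xi>) * (\<mu> * ?r))"
      and p_eq: "profile L \<mu> \<xi> = skew_pulse" using True rest by (simp_all add: amplitude_def profile_def)
    let ?\<kappa> = "integral {0..1} (\<lambda>s. skew_pulse s ^ L)"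
    have "a \<xi> * ?A ^ L * h * ?\<kappa> = - (sgn (\<xi> $ 1) * (\<bar>a \<xi>\<bar> * ?\<kappa> * \<mu> ^ L * \<bar>\<xi> $ 1\<bar> * h))"
      unfolding A_eq neg power_mult_distrib sgn_pow r(3) abs_eq[of "a \<xi>"] by (simp add: mult_ac)
    moreover have A_le: "\<bar>?A\<bar> \<le> \<mu> * ?r" using amplitude_bound[of \<xi>] True rest by simp
    moreover have "2 * Q * \<bar>?A\<bar> ^ Suc L * h \<le> 2 * Q * (\<mu> * ?r) ^ Suc L * h"
      using A_le Q h by (intro mult_right_mono mult_left_mono power_mono) auto
    ultimately have n1: "\<bar>X t1 $ 1 - \<xi> $ 1 + sgn (\<xi> $ 1) * (\<bar>a \<xi>\<bar> * ?\<kappa> * \<mu> ^ L * \<bar>\<xi> $ 1\<bar> * h)\<bar>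
        \<le> 2 * Q * (\<mu> * ?r) ^ Suc L * h"
      using net(1) unfolding p_eq by linarith
    have "2 * Q * \<bar>?A\<bar>\<^sup>2 * h \<le> 2 * Q * (\<mu> * ?r)\<^sup>2 * h"
      using A_le Q h by (intro mult_right_mono mult_left_mono power_mono) auto
    then have n2: "\<bar>X t1 $ 2 - \<xi> $ 2\<bar> \<le> 2 * Q * (\<mu> * ?r)\<^sup>2 * h"
      using net(2) unfolding p_eq integral_skew_pulse by simp
    show ?thesis
      using small_second_decrease[OF r _ h(1) h\<rho> a_bd \<gamma>(2)
          integral_control_shape_power_le_1[OF control_shape_skew_pulse] n1 n2] True
      by (simp add: lyap_def small_second_def)
  next
    case False
    have A_eq: "?A = - (sgn (\<xi> $ 2) * sgn (b \<xi>) * (\<mu> * \<bar>\<xi> $ 2\<bar>))"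
      and p_eq: "profile L \<mu> \<xi> = bump" using False rest by (simp_all add: amplitude_def profile_def)
    let ?\<kappa> = "integral {0..1} bump"
    have \<kappa>1: "?\<kappa> \<le> 1" using integral_control_shape_power_le_1[OF control_shape_bump, of 1] by simp
    have "b \<xi> * ?A * h * ?\<kappa> = - (sgn (\<xi> $ 2) * (\<bar>b \<xi>\<bar> * ?\<kappa> * \<mu> * \<bar>\<xi> $ 2\<bar> * h))"
      unfolding A_eq abs_eq[of "b \<xi>"] by (simp add: mult_ac)
    moreover have A_le: "\<bar>?A\<bar> \<le> \<mu> * \<bar>\<xi> $ 2\<bar>" using amplitude_bound[of \<xi>] False rest by simp
    moreover have "2 * Q * \<bar>?A\<bar>\<^sup>2 * h \<le> 2 * Q * (\<mu> * \<bar>\<xi> $ 2\<bar>)\<^sup>2 * h"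
      using A_le Q h by (intro mult_right_mono mult_left_mono power_mono) auto
    ultimately have n2: "\<bar>X t1 $ 2 - \<xi> $ 2 + sgn (\<xi> $ 2) * (\<bar>b \<xi>\<bar> * ?\<kappa> * \<mu> * \<bar>\<xi> $ 2\<bar> * h)\<bar>
        \<le> 2 * Q * (\<mu> * \<bar>\<xi> $ 2\<bar>)\<^sup>2 * h"
      using net(2) unfolding p_eq by linarith
    have "Q * \<bar>?A\<bar> ^ L * h \<le> Q * (\<mu> * \<bar>\<xi> $ 2\<bar>) ^ L * h"
      using A_le Q h by (intro mult_right_mono mult_left_mono power_mono) auto
    then have n1: "\<bar>X t1 $ 1 - \<xi> $ 1\<bar> \<le> Q * (\<mu> * \<bar>\<xi> $ 2\<bar>) ^ L * h" using disp(2) by linarith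
    have x2: "\<mu>\<^sup>2 * ?r \<le> \<bar>\<xi> $ 2\<bar>" "\<bar>\<xi> $ 2\<bar> \<le> \<rho>"
      using False component_le_norm_cart[of \<xi> 2] \<xi> by (auto simp: small_second_def)
    show ?thesis
      using large_second_decrease[OF r(1,3) x2 h(1) Qh b_bd \<gamma>(3) \<kappa>1 n1 n2] by (simp add: lyap_def)
  qed
qed

end

end

section \<open>The closed loop\<close>

text \<open>The bound \<open>3 * state_size\<close> on the motion until the next sample, expressed by the Lyapunov value of a
sampled state at rest; the absolute values make it a continuous function on the whole line.\<close>

definition rest_modulus :: "nat \<Rightarrow> real \<Rightarrow> real" where
  "rest_modulus L v = 3 * (\<bar>v\<bar> + 2 * root L \<bar>v\<bar>)"

lemma state_size_at_rest:
  assumes "L > 0" and "\<xi> $ 3 = 0"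
  shows "3 * state_size L \<xi> \<le> rest_modulus L (lyap L \<xi>)"
proof -
  have "\<bar>\<xi> $ 2\<bar> = root L (\<bar>\<xi> $ 2\<bar> ^ L)" using assms(1) by (simp add: real_root_power_cancel)
  also have "\<dots> \<le> root L (lyap L \<xi>)" using assms(1) by (simp add: lyap_def)
  finally have "\<bar>\<xi> $ 2\<bar> \<le> root L (lyap L \<xi>)" .
  moreover have "root L \<bar>\<xi> $ 1\<bar> \<le> root L (lyap L \<xi>)" using assms(1) by (simp add: lyap_def)
  moreover have "\<bar>\<xi> $ 1\<bar> \<le> lyap L \<xi>" by (simp add: lyap_def)
  ultimately show ?thesis using assms(2) by (simp add: state_size_def rest_modulus_def)
qed

locale sampled_steering = steering +
  fixes R :: real and T :: "nat \<Rightarrow> real"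
  assumes R: "R > 0" and T: "sampling_partition T"
    and \<rho>_def: "\<rho> = 2 * ((R + 1) + (R + 1) ^ L)"
begin

definition window :: "nat \<Rightarrow> real" where "window i = min (T (Suc i) - T i) hmax"

definition piece :: "nat \<Rightarrow> real \<Rightarrow> real ^ 3 \<Rightarrow> real ^ 1" where
  "piece i t \<xi> = pulse_control (amplitude a b L \<mu> \<xi>) (window i) (profile_deriv L \<mu> \<xi>) (T i) t"

definition feedback :: "real \<Rightarrow> real ^ 3 \<Rightarrow> real ^ 1" where
  "feedback t \<xi> = piece (sample_index T t) t \<xi>"

text \<open>The initial ramp may leave the ball of radius \<open>R\<close>, but then it ends at rest, below a fixed level
of the Lyapunov function. Adding only these states at rest, instead of enlarging the ball, gives a
set that is invariant at the sampling times; \<open>\<rho>\<close> bounds its elements.\<close>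

definition region :: "(real ^ 3) set" where
  "region = cball 0 R \<union> {\<xi>. \<xi> $ 3 = 0 \<and> lyap L \<xi> \<le> (R + 1) + (R + 1) ^ L}"

lemma T_less: "T i < T (Suc i)" using T by (simp add: sampling_partition_def strict_mono_less)

lemma window: "0 < window i" "window i \<le> hmax" "T i + window i \<le> T (Suc i)"
  using T_less[of i] hmax_pos by (auto simp: window_def)

lemma region_bound: "\<xi> \<in> region \<Longrightarrow> norm \<xi> \<le> \<rho>"
proof -
  let ?v = "(R + 1) + (R + 1) ^ L"
  have v: "?v \<ge> 1" "R \<le> ?v" using R one_le_power[of "R + 1" L] by auto
  assume "\<xi> \<in> region"
  then consider "norm \<xi> \<le> R" | "\<xi> $ 3 = 0" "lyap L \<xi> \<le> ?v" by (auto simp: region_def)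
  then show ?thesis
  proof cases
    case 1
    also have "R \<le> ?v" by (rule v)
    also have "?v \<le> 2 * ?v" using v(1) by simp
    finally show ?thesis by (simp only: \<rho>_def)
  next
    case 2
    have "\<bar>\<xi> $ 2\<bar> ^ L \<le> ?v ^ 1" using 2(2) by (simp add: lyap_def)
    also have "\<dots> \<le> ?v ^ L" using v L by (intro power_increasing) auto
    finally have "\<bar>\<xi> $ 2\<bar> \<le> ?v" using v L power_mono_iff[of "\<bar>\<xi> $ 2\<bar>" ?v L] by simp
    moreover have "\<bar>\<xi> $ 1\<bar> \<le> ?v" using 2(2) unfolding lyap_def
      using zero_le_power[OF abs_ge_zero, of "\<xi> $ 2" L] by linarith
    ultimately show ?thesis using norm_vec3_le[of \<xi>] 2(1) \<rho>_def by simp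
  qed
qed

text \<open>The only conflict is at the left end point, which belongs to the preceding interval; there the two
controls both vanish.\<close>

lemma feedback_on_segment:
  assumes "t \<in> {T i..T (Suc i)}"
  shows "feedback t \<xi> = piece i t \<xi>"
  using T assms
proof (cases rule: sample_index_cases)
  case 1
  then show ?thesis by (simp add: feedback_def)
next
  case (2 j)
  have "1 \<le> (T (Suc j) - T j) / window j" using window[of j] by (simp add: le_divide_eq)
  then have "profile_deriv L \<mu> \<xi> ((T (Suc j) - T j) / window j) = 0"
    and "profile_deriv L \<mu> \<xi> 0 = 0"
    using control_shape_profile[of L \<mu> \<xi>] by (simp_all add: control_shape_def)
  then show ?thesis using 2 by (simp add: feedback_def piece_def pulse_control_def)
qed

lemma admissible: "admissible_feedback region feedback"
proof -
  have "continuous_on UNIV (\<lambda>t. piece i t \<xi>)" for i \<xi>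
  proof -
    have "continuous_on UNIV (profile_deriv L \<mu> \<xi>)"
      using control_shape_profile[of L \<mu> \<xi>] by (simp add: control_shape_def)
    then have "continuous_on UNIV (\<lambda>t. profile_deriv L \<mu> \<xi> ((t - T i) / window i))"
      by (rule continuous_on_compose2) (use window(1)[of i] in \<open>auto intro!: continuous_intros\<close>)
    then show ?thesis
      unfolding piece_def pulse_control_def vec_def
      by (intro continuous_on_vec_lambda continuous_on_mult_left)
  qed
  then show ?thesis unfolding feedback_def[abs_def] by (rule admissible_piecewise_feedback[OF T])
qed

lemma segment_iff_steers:
  "segment_solution (cascade a b L) (\<lambda>s. feedback s \<xi>) (T i) (T (Suc i)) \<xi> X \<longleftrightarrow>
     steers \<xi> (window i) (T i) (T (Suc i)) X"
  unfolding steers_def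
  by (rule segment_solution_cong) (simp_all add: feedback_on_segment piece_def)

text \<open>From a state at rest the Lyapunov function decreases; from the ball, the first two states move by
at most \<open>1\<close>.\<close>

lemma region_invariant:
  assumes \<xi>: "\<xi> \<in> region" and X: "steers \<xi> (window i) (T i) (T (Suc i)) X"
  shows "X (T (Suc i)) \<in> region"
proof -
  note bd = region_bound[OF \<xi>]
  have rest: "X (T (Suc i)) $ 3 = 0" by (rule steers_end_at_rest[OF bd window X])
  have "lyap L (X (T (Suc i))) \<le> (R + 1) + (R + 1) ^ L"
  proof (cases "\<xi> $ 3 = 0 \<and> lyap L \<xi> \<le> (R + 1) + (R + 1) ^ L")
    case True
    have "0 \<le> rate * window i * lyap L \<xi>" using rate_pos window(1)[of i] lyap_nonneg by simp
    then show ?thesis using steers_decrease[OF bd window X] True by linarith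
  next
    case False
    then have "norm \<xi> \<le> R" using \<xi> by (auto simp: region_def)
    then have "\<bar>\<xi> $ 1\<bar> \<le> R" "\<bar>\<xi> $ 2\<bar> \<le> R"
      using component_le_norm_cart[of \<xi>] order_trans by blast+
    moreover have "T (Suc i) \<in> {T i..T (Suc i)}" using T_less[of i] by simp
    ultimately have "\<bar>X (T (Suc i)) $ 1\<bar> \<le> R + 1" "\<bar>X (T (Suc i)) $ 2\<bar> \<le> R + 1"
      using steers_intersample(2,3)[OF bd window X, of "T (Suc i)"] by linarith+
    then show ?thesis unfolding lyap_def by (intro add_mono power_mono) auto
  qed
  then show ?thesis using rest by (simp add: region_def)
qed

lemma trajectory_exists:
  assumes "x0 \<in> region"
  shows "\<exists>x. sampled_data_trajectory (cascade a b L) T region feedback x \<and> x 0 = x0"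
proof (rule sampled_data_trajectory_exists[OF T assms])
  fix i \<xi> assume \<xi>: "\<xi> \<in> region"
  obtain X where "steers \<xi> (window i) (T i) (T (Suc i)) X"
    using steers_exists[OF region_bound[OF \<xi>] window] by blast
  then show "\<exists>X. segment_solution (cascade a b L) (\<lambda>s. feedback s \<xi>) (T i) (T (Suc i)) \<xi> X \<and>
      X (T (Suc i)) \<in> region"
    unfolding segment_iff_steers using region_invariant[OF \<xi>] by blast
qed

context
  fixes x :: "real \<Rightarrow> real ^ 3"
  assumes x: "sampled_data_trajectory (cascade a b L) T region feedback x"
begin

lemma sampled_state: "norm (x (T i)) \<le> \<rho>" "steers (x (T i)) (window i) (T i) (T (Suc i)) x"
  using x region_bound by (simp_all add: sampled_data_trajectory_segments segment_iff_steers)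

lemma sampled_at_rest: "x (T (Suc i)) $ 3 = 0"
  by (rule steers_end_at_rest[OF sampled_state(1) window sampled_state(2)])

lemma intersample_bound: "t \<in> {T i..T (Suc i)} \<Longrightarrow> norm (x t) \<le> 3 * state_size L (x (T i))"
  by (rule steers_intersample(1)[OF sampled_state(1) window sampled_state(2)])

lemma intersample_bound_at_rest:
  "t \<in> {T (Suc i)..T (Suc (Suc i))} \<Longrightarrow> norm (x t) \<le> rest_modulus L (lyap L (x (T (Suc i))))"
  using intersample_bound state_size_at_rest[OF _ sampled_at_rest, of L i] L(1) order_trans by fastforce

lemma lyap_decseq: "decseq (\<lambda>i. lyap L (x (T (Suc i))))"
  and lyap_tendsto_0: "(\<lambda>i. lyap L (x (T (Suc i)))) \<longlonglongrightarrow> 0"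
proof -
  have "\<not> summable window"
    unfolding window_def using T hmax_pos
    by (intro truncated_gaps_not_summable) (auto simp: sampling_partition_def)
  then have ns: "\<not> summable (\<lambda>i. window (Suc i))" by (simp add: summable_Suc_iff)
  have step: "lyap L (x (T (Suc (Suc i)))) \<le> lyap L (x (T (Suc i))) -
      rate * window (Suc i) * lyap L (x (T (Suc i)))" for i
    by (rule steers_decrease[OF sampled_state(1) window sampled_state(2) sampled_at_rest])
  have w: "window (Suc i) \<ge> 0" for i using window(1)[of "Suc i"] by simp
  show "decseq (\<lambda>i. lyap L (x (T (Suc i))))" "(\<lambda>i. lyap L (x (T (Suc i)))) \<longlonglongrightarrow> 0"
    using decay_along_divergent_steps[of "\<lambda>i. lyap L (x (T (Suc i)))" "\<lambda>i. window (Suc i)" rate,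
        OF lyap_nonneg w rate_pos ns step] by blast+
qed

lemma trajectory_tendsto_0: "(x \<longlongrightarrow> 0) at_top"
proof (rule tendstoI)
  fix e :: real assume "e > 0"
  have "isCont (rest_modulus L) 0" unfolding rest_modulus_def by (intro continuous_intros)
  then have "(\<lambda>i. rest_modulus L (lyap L (x (T (Suc i))))) \<longlonglongrightarrow> rest_modulus L 0"
    using lyap_tendsto_0 by (rule isCont_tendsto_compose)
  then have "(\<lambda>i. rest_modulus L (lyap L (x (T (Suc i))))) \<longlonglongrightarrow> 0" by (simp add: rest_modulus_def)
  then have "\<forall>\<^sub>F i in sequentially. rest_modulus L (lyap L (x (T (Suc i)))) < e"
    using \<open>e > 0\<close> by (rule order_tendstoD)
  then obtain N where N: "\<And>i. i \<ge> N \<Longrightarrow> rest_modulus L (lyap L (x (T (Suc i)))) < e"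
    by (auto simp: eventually_sequentially)
  show "\<forall>\<^sub>F t in at_top. dist (x t) 0 < e"
    using eventually_gt_at_top[of "max 0 (T (Suc N))"]
  proof eventually_elim
    case (elim t)
    define i where "i = sample_index T t"
    have t: "t \<in> {T i..T (Suc i)}" unfolding i_def using elim by (intro sample_index_at_start[OF T]) simp
    have "T (Suc N) < T (Suc i)" using t elim by simp
    then have "N < i" using T by (simp add: sampling_partition_def strict_mono_less)
    then obtain j where j: "i = Suc j" "N \<le> j" by (cases i) auto
    show ?case using intersample_bound_at_rest[of t j] t N[OF j(2)] j(1) by simp
  qed
qed

end

text \<open>After the first interval the Lyapunov values at the samples are bounded by the first of them, which is
small because the state cannot move far on the first interval.\<close>

lemma trajectory_stable:
  assumes "e > 0"
  obtains d where "d > 0" and "\<And>x t. sampled_data_trajectory (cascade a b L) T region feedback x \<Longrightarrow>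
      norm (x 0) \<le> d \<Longrightarrow> t \<ge> 0 \<Longrightarrow> norm (x t) \<le> e"
proof -
  have cont: "isCont (rest_modulus L) 0" "isCont (lyap L) 0" "isCont (\<lambda>\<xi>. 3 * state_size L \<xi>) 0"
    unfolding rest_modulus_def[abs_def] lyap_def[abs_def] state_size_def[abs_def]
    by (intro continuous_intros; simp)+
  have zero: "rest_modulus L 0 = 0" "lyap L 0 = 0" "3 * state_size L 0 = 0"
    using L by (simp_all add: rest_modulus_def lyap_def state_size_def)
  obtain d1 where d1: "d1 > 0" "\<And>v. norm v \<le> d1 \<Longrightarrow> rest_modulus L v \<le> e"
    using isCont_zero_bound[OF cont(1) zero(1) assms] by blast
  obtain d2 where d2: "d2 > 0" "\<And>\<xi>. norm \<xi> \<le> d2 \<Longrightarrow> lyap L \<xi> \<le> d1"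
    using isCont_zero_bound[OF cont(2) zero(2) d1(1)] by blast
  obtain d3 where d3: "d3 > 0" "\<And>\<xi>. norm \<xi> \<le> d3 \<Longrightarrow> 3 * state_size L \<xi> \<le> min e d2"
    using isCont_zero_bound[OF cont(3) zero(3), of "min e d2"] assms d2(1) by auto
  show thesis
  proof (rule that[OF d3(1)])
    fix x t assume x: "sampled_data_trajectory (cascade a b L) T region feedback x"
      and x0: "norm (x 0) \<le> d3" and "t \<ge> (0::real)"
    define i where "i = sample_index T t"
    have t: "t \<in> {T i..T (Suc i)}" unfolding i_def using \<open>t \<ge> 0\<close> by (rule sample_index_at_start[OF T])
    have first: "norm (x s) \<le> min e d2" if "s \<in> {T 0..T (Suc 0)}" for s
      using intersample_bound[OF x that] d3(2)[OF x0] T by (simp add: sampling_partition_def)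
    show "norm (x t) \<le> e"
    proof (cases i)
      case 0
      then show ?thesis using first[of t] t by simp
    next
      case (Suc j)
      have "norm (x (T (Suc 0))) \<le> d2" using first[of "T (Suc 0)"] T_less[of 0] by simp
      then have "lyap L (x (T (Suc 0))) \<le> d1" by (rule d2(2))
      moreover have "lyap L (x (T (Suc j))) \<le> lyap L (x (T (Suc 0)))"
        using lyap_decseq[OF x] by (simp add: decseq_def)
      ultimately have "rest_modulus L (lyap L (x (T (Suc j)))) \<le> e"
        using lyap_nonneg by (intro d1(2)) simp
      then show ?thesis using intersample_bound_at_rest[OF x, of t j] t Suc by simp
    qed
  qed
qed

end

theorem corollary2:
  fixes L :: nat and a b :: "real ^ 3 \<Rightarrow> real"
  assumes "L \<ge> 3" and "odd L"
    and "smooth a" and "smooth b"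
    and "\<And>x. a x \<noteq> 0" and "\<And>x. b x \<noteq> 0"
  shows "SDF_SGAS (\<lambda>(x :: real ^ 3) (u :: real ^ 1).
           vector [a x * (x $ 3) ^ L, b x * (x $ 3), u $ 1])"
proof -
  have "SDF_SGAS (cascade a b L)"
    unfolding SDF_SGAS_def
  proof (intro conjI allI impI)
    show "cascade a b L 0 0 = 0" using assms(1) by (simp add: vec_eq_iff forall_3)
    fix R :: real and T assume R: "R > 0" and T: "sampling_partition T"
    define \<rho> where "\<rho> = 2 * ((R + 1) + (R + 1) ^ L)"
    have \<rho>: "\<rho> \<ge> 1" using R one_le_power[of "R + 1" L] by (simp add: \<rho>_def)
    let ?B = "cball 0 (5 * \<rho>) :: (real ^ 3) set"
    have cont: "continuous_on S a" "continuous_on S b" for S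
      using assms(3,4)[unfolded smooth_def, rule_format, of 0]
      by (auto intro: continuous_on_subset)
    obtain Ba where Ba: "\<And>z. z \<in> ?B \<Longrightarrow> norm (a z) \<le> Ba"
      using continuous_on_compact_bound[OF compact_cball cont(1)] by blast
    obtain Bb where Bb: "\<And>z. z \<in> ?B \<Longrightarrow> norm (b z) \<le> Bb"
      using continuous_on_compact_bound[OF compact_cball cont(2)] by blast
    obtain Ca where Ca: "\<And>z w. z \<in> ?B \<Longrightarrow> w \<in> ?B \<Longrightarrow> norm (a z - a w) \<le> Ca * norm (z - w)"
      using smooth_lipschitz_on_compact_convex[OF assms(3) compact_cball convex_cball] by blast
    obtain Cb where Cb: "\<And>z w. z \<in> ?B \<Longrightarrow> w \<in> ?B \<Longrightarrow> norm (b z - b w) \<le> Cb * norm (z - w)"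
      using smooth_lipschitz_on_compact_convex[OF assms(4) compact_cball convex_cball] by blast
    define Q where "Q = Max {1, Ba, Bb, Ca, Cb}"
    have Q: "1 \<le> Q" "Ba \<le> Q" "Bb \<le> Q" "Ca \<le> Q" "Cb \<le> Q" by (simp_all add: Q_def)
    have bl: "bounded_lipschitz_on ?B Q g" if "\<And>z. z \<in> ?B \<Longrightarrow> norm (g z) \<le> B" "B \<le> Q"
      "\<And>z w. z \<in> ?B \<Longrightarrow> w \<in> ?B \<Longrightarrow> norm (g z - g w) \<le> C * norm (z - w)" "C \<le> Q" for g :: "real ^ 3 \<Rightarrow> real" and B C
      unfolding bounded_lipschitz_on_def
    proof (intro conjI ballI)
      show "\<bar>g z\<bar> \<le> Q" if "z \<in> ?B" for z
        using \<open>\<And>z. z \<in> ?B \<Longrightarrow> norm (g z) \<le> B\<close>[OF that] \<open>B \<le> Q\<close> by simp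
      show "\<bar>g z - g w\<bar> \<le> Q * norm (z - w)" if "z \<in> ?B" "w \<in> ?B" for z w
        using \<open>\<And>z w. z \<in> ?B \<Longrightarrow> w \<in> ?B \<Longrightarrow> norm (g z - g w) \<le> C * norm (z - w)\<close>[OF that]
          mult_right_mono[OF \<open>C \<le> Q\<close> norm_ge_zero[of "z - w"]] by simp
    qed
    have low: "\<exists>m>0. \<forall>z\<in>cball 0 \<rho>. m \<le> \<bar>g z\<bar>"
      if "continuous_on (cball 0 \<rho>) g" "\<And>z. g z \<noteq> 0" for g :: "real ^ 3 \<Rightarrow> real"
    proof -
      have "continuous_on (cball 0 \<rho>) (\<lambda>z. \<bar>g z\<bar>)" using that(1) by (rule continuous_on_rabs)
      moreover have "cball (0 :: real ^ 3) \<rho> \<noteq> {}" using \<rho> by simp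
      ultimately obtain z0 where "\<forall>z\<in>cball 0 \<rho>. \<bar>g z0\<bar> \<le> \<bar>g z\<bar>"
        using continuous_attains_inf[OF compact_cball] by blast
      then show ?thesis using that(2)[of z0] by (intro exI[of _ "\<bar>g z0\<bar>"]) simp
    qed
    obtain ma where ma: "ma > 0" "\<And>z. z \<in> cball 0 \<rho> \<Longrightarrow> ma \<le> \<bar>a z\<bar>" using low[OF cont(1) assms(5)] by blast
    obtain mb where mb: "mb > 0" "\<And>z. z \<in> cball 0 \<rho> \<Longrightarrow> mb \<le> \<bar>b z\<bar>" using low[OF cont(2) assms(6)] by blast
    define m where "m = min ma mb"
    define \<gamma> where "\<gamma> = min (integral {0..1} (\<lambda>s. skew_pulse s ^ L)) (integral {0..1} bump)"
    have \<gamma>: "\<gamma> > 0"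
      using integral_skew_pulse_power_pos[OF assms(1,2)] integral_bump_power_pos[of 1] by (simp add: \<gamma>_def)
    define \<mu> where "\<mu> = min 1 (m * \<gamma> / (2 ^ (L + 2) * real L * Q * \<rho>))"
    have denom: "0 < 2 ^ (L + 2) * real L * Q * \<rho>" using assms(1) Q(1) \<rho> by simp
    have m: "m > 0" using ma(1) mb(1) by (simp add: m_def)
    have "\<mu> \<le> m * \<gamma> / (2 ^ (L + 2) * real L * Q * \<rho>)" by (simp add: \<mu>_def)
    then have \<mu>: "2 ^ (L + 2) * real L * Q * \<rho> * \<mu> \<le> m * \<gamma>"
      using denom by (simp add: pos_le_divide_eq mult.commute)
    have \<mu>0: "\<mu> > 0" "\<mu> \<le> 1" using m \<gamma> denom by (simp_all add: \<mu>_def)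
    have a: "bounded_lipschitz_on ?B Q a" by (rule bl[where B = Ba and C = Ca]) (use Ba Ca Q in auto)
    have b: "bounded_lipschitz_on ?B Q b" by (rule bl[where B = Bb and C = Cb]) (use Bb Cb Q in auto)
    interpret sampled_steering a b L Q \<rho> m \<mu> \<gamma> R T
    proof
      show "m \<le> \<bar>a z\<bar>" "m \<le> \<bar>b z\<bar>" if "norm z \<le> \<rho>" for z
        using ma(2)[of z] mb(2)[of z] that by (simp_all add: m_def)
      show "\<gamma> \<le> integral {0..1} (\<lambda>s. skew_pulse s ^ L)" "\<gamma> \<le> integral {0..1} bump" by (simp_all add: \<gamma>_def)
    qed (fact assms(1,2) Q(1) \<rho> a b m \<gamma> \<mu>0 \<mu> R T \<rho>_def)+
    have "ball 0 R \<subseteq> region" by (auto simp: region_def)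
    then have "0 \<in> interior region" using R by (intro interiorI[OF open_ball]) auto
    moreover have "cball 0 R \<subseteq> region" by (simp add: region_def)
    ultimately show "\<exists>D k. 0 \<in> interior D \<and> cball 0 R \<subseteq> D \<and> admissible_feedback D k \<and>
         (\<forall>x0\<in>D. \<exists>x. sampled_data_trajectory (cascade a b L) T D k x \<and> x 0 = x0) \<and>
         (\<forall>\<epsilon>>0. \<exists>\<delta>>0. \<forall>x. sampled_data_trajectory (cascade a b L) T D k x \<and> norm (x 0) \<le> \<delta> \<longrightarrow>
            (\<forall>t\<ge>0. norm (x t) \<le> \<epsilon>)) \<and>
         (\<forall>x. sampled_data_trajectory (cascade a b L) T D k x \<longrightarrow> (x \<longlongrightarrow> 0) at_top)"
      using admissible trajectory_exists trajectory_tendsto_0 trajectory_stable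
      by (intro exI[of _ region] exI[of _ feedback]) (simp, metis)
  qed
  then show ?thesis by (simp add: cascade_def[abs_def])
qed

end
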